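(* Let $\alpha \in (1,2)$ and let $\mu_\alpha$ be a non-degenerate symmetric $\alpha$-stable probability measure on $\mathbb{R}^d$, $d \geq 1$. Then, $$\lim_{t \rightarrow 0^+} \frac{K_t^{\alpha}(\mathring{K}_\alpha, (\mathring{K}_\alpha)^c)}{t^{\frac{1}{\alpha}}} = \frac{\Gamma(1- \frac{1}{\alpha})}{\pi}\, d\, \mathcal{L}_d(\mathring{K}_\alpha) = \frac{\Gamma(1- \frac{1}{\alpha})}{\pi}\, \mathcal{P}_\alpha^{\mathrm{var}} (\mathring{K}_\alpha).$$
   Context: $\langle\cdot;\cdot\rangle$ is the Euclidean inner product on $\mathbb{R}^d$, $\mathbb{S}^{d-1}$ the Euclidean unit sphere, $\mathcal{L}_d$ is $d$-dimensional Lebesgue measure, $\Gamma$ the Euler Gamma function. Let $\sigma$ be a finite positive symmetric ($\sigma(B)=\sigma(-B)$) Borel measure on $\mathbb{S}^{d-1}$ and $\lambda_1 = -\cos(\alpha\pi/2)\frac{\Gamma(2-\alpha)}{\alpha(\alpha-1)}\sigma$ its spectral measure, non-degenerate in the sense that $\inf_{y\in\mathbb{S}^{d-1}}\int_{\mathbb{S}^{d-1}}|\langle y;x\rangle|^\alpha\lambda_1(dx)>0$. Set $\sigma_\alpha(\xi)=(\int_{\mathbb{S}^{d-1}}|\langle y;\xi\rangle|^\alpha\lambda_1(dy))^{1/\alpha}$, which is a norm on $\mathbb{R}^d$; the non-degenerate symmetric $\alpha$-stable probability measure $\mu_\alpha$ is characterized by $\int e^{i\langle y;\xi\rangle}\mu_\alpha(dy)=\exp(-\sigma_\alpha(\xi)^\alpha)$.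 Set $P_t^\alpha(f)(x)=\int_{\mathbb{R}^d}f(x+t^{1/\alpha}y)\mu_\alpha(dy)$ and, for Borel sets $A,B\subset\mathbb{R}^d$ and $t\geq0$, $K_t^\alpha(A,B)=\int_{\mathbb{R}^d}P_t^\alpha(\mathbf{1}_A)(x)\mathbf{1}_B(x)dx$. Let $K_\alpha=\{z\in\mathbb{R}^d:\sigma_\alpha(z)\leq1\}$, let $\mathring{K}_\alpha=\{x\in\mathbb{R}^d:\langle x;z\rangle\leq1\ \text{for all } z\in K_\alpha\}$ be its polar set, and $\sigma_\alpha^*(x)=\sup_{\sigma_\alpha(z)\leq1}|\langle x;z\rangle|$ the dual norm. For a Borel set $E$ with $\mathcal{L}_d(E)<+\infty$, $$\mathcal{P}_\alpha^{\mathrm{var}}(E)=\sup\left\{\int_E\mathrm{div}(\phi)(x)dx:\ \phi\in\mathcal{C}_c^1(\mathbb{R}^d,\mathbb{R}^d),\ \|\sigma_\alpha^*(\phi)\|_\infty\leq1\right\}.$$ *)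

theory Defs
  imports "HOL-Probability.Probability"
begin

definition finite_symmetric_sphere_measure :: "'a::euclidean_space measure \<Rightarrow> bool" where
  "finite_symmetric_sphere_measure \<sigma> \<longleftrightarrow>
     sets \<sigma> = sets (restrict_space borel (sphere 0 1)) \<and> finite_measure \<sigma> \<and>
     (\<forall>B \<in> sets \<sigma>. emeasure \<sigma> (uminus ` B) = emeasure \<sigma> B)"

(* The constant is positive for 1 < \<alpha> < 2, so nothing is truncated by ennreal in that range. *)
definition spectral_measure :: "real \<Rightarrow> 'a::euclidean_space measure \<Rightarrow> 'a measure" where
  "spectral_measure \<alpha> \<sigma> =
     scale_measure (ennreal (- cos (\<alpha> * pi / 2) * (Gamma (2 - \<alpha>) / (\<alpha> * (\<alpha> - 1))))) \<sigma>"

definition nondegenerate_spectral :: "real \<Rightarrow> 'a::euclidean_space measure \<Rightarrow> bool" where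
  "nondegenerate_spectral \<alpha> \<sigma> \<longleftrightarrow>
     (INF y\<in>sphere 0 1. LINT x|spectral_measure \<alpha> \<sigma>. \<bar>y \<bullet> x\<bar> powr \<alpha>) > 0"

definition stable_norm :: "real \<Rightarrow> 'a::euclidean_space measure \<Rightarrow> 'a \<Rightarrow> real" where
  "stable_norm \<alpha> \<sigma> \<xi> = (LINT y|spectral_measure \<alpha> \<sigma>. \<bar>y \<bullet> \<xi>\<bar> powr \<alpha>) powr (1 / \<alpha>)"

definition nondegenerate_symmetric_stable ::
    "real \<Rightarrow> 'a::euclidean_space measure \<Rightarrow> 'a measure \<Rightarrow> bool" where
  "nondegenerate_symmetric_stable \<alpha> \<sigma> \<mu> \<longleftrightarrow>
     finite_symmetric_sphere_measure \<sigma> \<and> nondegenerate_spectral \<alpha> \<sigma> \<and>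
     prob_space \<mu> \<and> sets \<mu> = sets borel \<and>
     (\<forall>\<xi>. (LINT y|\<mu>. exp (\<i> * complex_of_real (y \<bullet> \<xi>))) =
           complex_of_real (exp (- (stable_norm \<alpha> \<sigma> \<xi> powr \<alpha>))))"

definition stable_semigroup ::
    "real \<Rightarrow> 'a::euclidean_space measure \<Rightarrow> real \<Rightarrow> ('a \<Rightarrow> real) \<Rightarrow> 'a \<Rightarrow> real" where
  "stable_semigroup \<alpha> \<mu> t f x = (LINT y|\<mu>. f (x + t powr (1 / \<alpha>) *\<^sub>R y))"

(* Valued in ennreal because the integral diverges for some Borel sets A, B. *)
definition heat_content ::
    "real \<Rightarrow> 'a::euclidean_space measure \<Rightarrow> real \<Rightarrow> 'a set \<Rightarrow> 'a set \<Rightarrow> ennreal" where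
  "heat_content \<alpha> \<mu> t A B =
     (\<integral>\<^sup>+ x. ennreal (stable_semigroup \<alpha> \<mu> t (indicat_real A) x) * indicator B x \<partial>lborel)"

definition stable_ball :: "real \<Rightarrow> 'a::euclidean_space measure \<Rightarrow> 'a set" where
  "stable_ball \<alpha> \<sigma> = {z. stable_norm \<alpha> \<sigma> z \<le> 1}"

definition polar_set :: "'a::euclidean_space set \<Rightarrow> 'a set" where
  "polar_set K = {x. \<forall>z\<in>K. x \<bullet> z \<le> 1}"

definition stable_dual_norm :: "real \<Rightarrow> 'a::euclidean_space measure \<Rightarrow> 'a \<Rightarrow> real" where
  "stable_dual_norm \<alpha> \<sigma> x = (SUP z\<in>{z. stable_norm \<alpha> \<sigma> z \<le> 1}. \<bar>x \<bullet> z\<bar>)"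

definition C1_compact_support :: "('a::euclidean_space \<Rightarrow> 'a) \<Rightarrow> bool" where
  "C1_compact_support \<phi> \<longleftrightarrow>
     (\<exists>\<phi>' :: 'a \<Rightarrow> 'a \<Rightarrow>\<^sub>L 'a.
        (\<forall>x. (\<phi> has_derivative blinfun_apply (\<phi>' x)) (at x)) \<and> continuous_on UNIV \<phi>') \<and>
     compact (closure {x. \<phi> x \<noteq> 0})"

definition divergence :: "('a::euclidean_space \<Rightarrow> 'a) \<Rightarrow> 'a \<Rightarrow> real" where
  "divergence \<phi> x = (\<Sum>b\<in>Basis. frechet_derivative \<phi> (at x) b \<bullet> b)"

(* Suprema are taken in ereal so that an unbounded family has supremum \<infinity>; for the continuous
   functions \<sigma>*(\<phi>) the essential supremum norm is the supremum norm. *)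
definition stable_perimeter :: "real \<Rightarrow> 'a::euclidean_space measure \<Rightarrow> 'a set \<Rightarrow> ereal" where
  "stable_perimeter \<alpha> \<sigma> E =
     (SUP \<phi>\<in>{\<phi>. C1_compact_support \<phi> \<and>
               (SUP x. ereal \<bar>stable_dual_norm \<alpha> \<sigma> (\<phi> x)\<bar>) \<le> 1}.
        ereal (LINT x:E|lborel. divergence \<phi> x))"

end

theory Submission
  imports Defs
begin

text \<open>
  Let \<open>M = \<sigma>\<^sub>\<alpha>\<close>, let \<open>N\<close> be its dual norm and \<open>W\<close> the unit ball of \<open>N\<close>, which is the polar set in
  question. Since \<open>\<alpha> > 1\<close>, \<open>M\<close> is strictly convex, so the maximizer \<open>\<xi> x\<close> of \<open>z \<mapsto> x \<bullet> z\<close> on \<open>M \<le> 1\<close> is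
  unique and depends continuously on \<open>x \<noteq> 0\<close>. Hence \<open>N\<close> is \<open>C\<^sup>1\<close> off the origin with gradient \<open>\<xi>\<close>, where
  \<open>M (\<xi> x) = 1\<close> and \<open>v \<bullet> \<xi> x \<le> N v\<close>. All surface integrals are replaced by volume integrals against
  functions of \<open>N\<close>.

  \<^item> Perimeter: testing \<open>div \<phi>\<close> against a function of \<open>N\<close> that drops linearly from \<open>1\<close> to \<open>0\<close> on \<open>1 \<le> N \<le> 1 + \<epsilon>\<close>
    gives at most \<open>((1 + \<epsilon>)\<^sup>d - 1) |W| / \<epsilon>\<close>, because \<open>\<phi> \<bullet> \<xi> \<le> 1\<close>; the bound \<open>d |W|\<close> is approached by
    cut-offs of \<open>\<phi> x = x\<close>.

  \<^item> Heat content: it equals \<open>h (t powr (1 / \<alpha>))\<close> with \<open>h s = E |{x \<in> W. x + s Y \<notin> W}|\<close>, where \<open>Y\<close> has law \<open>\<mu>\<close>.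
    As \<open>h\<close> is subadditive and \<open>h s = O(s)\<close>, the limit \<open>L\<close> of \<open>h s / s\<close> exists. The layer cake formula for
    \<open>max 0 (1 - N)\<close> expresses \<open>L / d\<close> as \<open>E \<integral>\<^sub>W max 0 (Y \<bullet> \<xi> x) dx = 1/2 \<integral>\<^sub>W E |Y \<bullet> \<xi> x| dx\<close>, and
    \<open>E |Y \<bullet> \<xi>| = 2/\<pi> \<Gamma>(1 - 1/\<alpha>) M \<xi>\<close> follows from the characteristic function and
    \<open>|z| = 2/\<pi> \<integral>\<^sub>0\<^sup>\<infinity> (1 - cos (z t)) / t\<^sup>2 dt\<close>.
\<close>

section \<open>Absolute moments from the characteristic function\<close>

text \<open>Integration by parts reduces the integral to the sine integral, whose limit at infinity
  is pi / 2. The result expresses \<open>\<bar>z\<bar>\<close> through functions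
  \<open>1 - cos (z * t)\<close>, which a characteristic function can integrate.\<close>

lemma nn_integral_one_minus_cos:
  fixes z :: real
  shows "(\<integral>\<^sup>+t\<in>{0<..}. ennreal ((1 - cos (z * t)) / t\<^sup>2) \<partial>lborel) = ennreal (pi / 2 * \<bar>z\<bar>)"
proof (cases "z = 0")
  case False
  \<comment> \<open>By \<open>1 - cos (z * t) = 2 * (sin (z * t / 2))\<^sup>2\<close> this is the
    integrand; writing it with \<open>sinc\<close> removes the singularity at 0.\<close>
  define f where "f t = z\<^sup>2 / 2 * (sinc (z * t / 2))\<^sup>2" for t
  \<comment> \<open>For nonzero \<open>t\<close> the product \<open>t * f t\<close> is
    \<open>(1 - cos (z * t)) / t\<close>, the boundary term of the integration by parts, so
    \<open>F\<close> is an antiderivative of \<open>f\<close>.\<close>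
  define F where "F t = \<bar>z\<bar> * Si (\<bar>z\<bar> * t) - t * f t" for t
  have f_eq: "f t = (1 - cos (z * t)) / t\<^sup>2" if "t \<noteq> 0" for t
    using that False cos_double_sin[of "z * t / 2"] unfolding f_def
    by (simp add: field_simps power_divide power2_eq_square)
  have f_cont: "continuous_on UNIV f"
    unfolding f_def by (intro continuous_intros) auto
  have f_borel: "f \<in> borel_measurable borel"
    by (rule borel_measurable_continuous_onI[OF f_cont])
  have deriv: "(F has_real_derivative f t) (at t)" for t
  proof (cases "t = 0")
    case True
    \<comment> \<open>The difference quotient of \<open>t * f t\<close> at 0 is \<open>f t\<close>
      itself, so continuity of \<open>f\<close> replaces the product rule.\<close>
    have "((\<lambda>t. t * f t) has_real_derivative f 0) (at 0)"
    proof -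
      have "(f \<longlongrightarrow> f 0) (at 0)"
        using f_cont by (simp add: continuous_on_def)
      then have "((\<lambda>t. (t * f t - 0 * f 0) / (t - 0)) \<longlongrightarrow> f 0) (at 0)"
        by (rule Lim_transform_eventually) (auto simp: eventually_at_filter)
      then show ?thesis
        by (simp add: has_field_derivative_iff)
    qed
    moreover have "((\<lambda>t. \<bar>z\<bar> * Si (\<bar>z\<bar> * t)) has_real_derivative \<bar>z\<bar> * (sinc (\<bar>z\<bar> * 0) * \<bar>z\<bar>)) (at 0)"
      by (rule DERIV_cmult, rule DERIV_chain2[OF DERIV_Si])
        (auto intro!: derivative_eq_intros)
    ultimately have "(F has_real_derivative \<bar>z\<bar> * (sinc (\<bar>z\<bar> * 0) * \<bar>z\<bar>) - f 0) (at 0)"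
      unfolding F_def by (rule DERIV_diff[rotated])
    moreover have "\<bar>z\<bar> * (sinc (\<bar>z\<bar> * 0) * \<bar>z\<bar>) - f 0 = f 0"
      by (simp add: f_def power2_eq_square)
    ultimately show ?thesis using True by simp
  next
    case t: False
    have "((\<lambda>t. \<bar>z\<bar> * Si (\<bar>z\<bar> * t) - (1 - cos (z * t)) / t) has_real_derivative
       \<bar>z\<bar> * (sinc (\<bar>z\<bar> * t) * \<bar>z\<bar>) - (sin (z * t) * z * t - (1 - cos (z * t))) / (t * t)) (at t)"
      using t by (intro DERIV_diff DERIV_cmult DERIV_chain2[OF DERIV_Si])
        (auto intro!: derivative_eq_intros)
    moreover have "\<bar>z\<bar> * (sinc (\<bar>z\<bar> * t) * \<bar>z\<bar>) - (sin (z * t) * z * t - (1 - cos (z * t))) / (t * t) = f t"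
      using t False by (simp add: f_eq field_simps power2_eq_square abs_if)
    ultimately have "((\<lambda>t. \<bar>z\<bar> * Si (\<bar>z\<bar> * t) - (1 - cos (z * t)) / t) has_real_derivative f t) (at t)"
      by simp
    then show ?thesis
    proof (rule has_field_derivative_transform_within_open[where S="-{0}"])
      fix x :: real assume "x \<in> -{0}"
      then show "\<bar>z\<bar> * Si (\<bar>z\<bar> * x) - (1 - cos (z * x)) / x = F x"
        by (simp add: F_def f_eq power2_eq_square)
    qed (use t in auto)
  qed
  have lim1: "((\<lambda>t. \<bar>z\<bar> * Si (\<bar>z\<bar> * t)) \<longlongrightarrow> \<bar>z\<bar> * (pi / 2)) at_top"
    using False by (intro tendsto_mult tendsto_const filterlim_compose[OF Si_at_top]
        filterlim_tendsto_pos_mult_at_top[OF tendsto_const] filterlim_ident) auto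
  have lim2: "((\<lambda>t. t * f t) \<longlongrightarrow> 0) at_top"
  proof (rule tendsto_sandwich[where f="\<lambda>_. 0" and h="\<lambda>t. 2 / t"])
    show "\<forall>\<^sub>F t in at_top. t * f t \<le> 2 / t"
      using eventually_gt_at_top[of 0]
    proof eventually_elim
      case (elim t)
      have "(1 - cos (z * t)) / t \<le> 2 / t"
        using elim cos_ge_minus_one[of "z * t"] by (intro divide_right_mono) auto
      then show ?case using elim by (simp add: f_eq power2_eq_square)
    qed
    show "\<forall>\<^sub>F t in at_top. 0 \<le> t * f t"
      using eventually_ge_at_top[of 0] by eventually_elim (simp add: f_def)
    show "((\<lambda>t. 2 / t) \<longlongrightarrow> (0::real)) at_top"
      by (rule tendsto_divide_0[OF tendsto_const filterlim_at_top_imp_at_infinity[OF filterlim_ident]])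
  qed simp
  have lim: "(F \<longlongrightarrow> \<bar>z\<bar> * (pi / 2)) at_top"
    unfolding F_def using tendsto_diff[OF lim1 lim2] by simp
  have "(\<integral>\<^sup>+t. ennreal (f t) * indicator {0..} t \<partial>lborel) = ennreal (\<bar>z\<bar> * (pi / 2) - F 0)"
    by (rule nn_integral_FTC_atLeast[OF f_borel deriv _ lim]) (simp add: f_def)
  moreover have "F 0 = 0"
    by (simp add: F_def Si_def flip: zero_ereal_def)
  moreover have "(\<integral>\<^sup>+t\<in>{0<..}. ennreal ((1 - cos (z * t)) / t\<^sup>2) \<partial>lborel)
      = (\<integral>\<^sup>+t. ennreal (f t) * indicator {0..} t \<partial>lborel)"
    using AE_lborel_singleton[of "0::real"]
    by (intro nn_integral_cong_AE) (auto simp: f_eq indicator_def)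
  ultimately show ?thesis
    by (simp add: mult.commute)
qed simp

lemma nn_integral_inverse_square_tail:
  fixes a :: real
  assumes "a > 0"
  shows "(\<integral>\<^sup>+t\<in>{a..}. ennreal (1 / t\<^sup>2) \<partial>lborel) = ennreal (1 / a)"
proof -
  have "(\<integral>\<^sup>+t. ennreal (1 / t\<^sup>2) * indicator {a..} t \<partial>lborel) = ennreal (0 - (- 1 / a))"
  proof (rule nn_integral_FTC_atLeast)
    show "((\<lambda>t. - 1 / t) \<longlongrightarrow> (0::real)) at_top"
      by (rule tendsto_divide_0[OF tendsto_const filterlim_at_top_imp_at_infinity[OF filterlim_ident]])
    show "((\<lambda>t. - 1 / t) has_real_derivative 1 / x\<^sup>2) (at x)" if "a \<le> x" for x
      using that assms by (auto intro!: derivative_eq_intros simp: power2_eq_square)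
  qed auto
  then show ?thesis by simp
qed

lemma nn_integral_Gamma:
  fixes x :: real
  assumes "x > 0"
  shows "(\<integral>\<^sup>+u\<in>{0<..}. ennreal (u powr (x - 1) * exp (- u)) \<partial>lborel) = ennreal (Gamma x)"
proof -
  have "((\<lambda>t. t powr (x - 1) * exp (- t)) has_integral Gamma x) {0..}"
    using Gamma_integral_real[OF assms] by (simp add: exp_minus field_simps)
  then have "(\<integral>\<^sup>+u\<in>{0..}. ennreal (u powr (x - 1) * exp (- u)) \<partial>lborel) = ennreal (Gamma x)"
    by (intro nn_integral_has_integral_lebesgue') auto
  moreover have "(\<integral>\<^sup>+u\<in>{0<..}. ennreal (u powr (x - 1) * exp (- u)) \<partial>lborel)
      = (\<integral>\<^sup>+u\<in>{0..}. ennreal (u powr (x - 1) * exp (- u)) \<partial>lborel)"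
    using AE_lborel_singleton[of "0::real"]
    by (intro nn_integral_cong_AE) (auto simp: indicator_def)
  ultimately show ?thesis by simp
qed

text \<open>Writing \<open>1 - exp (- (m t)\<^sup>\<alpha>)\<close> as the integral of \<open>exp (- u)\<close> over \<open>0 < u < (m t)\<^sup>\<alpha>\<close> and
  exchanging the integrals turns the left-hand side into the Gamma integral.\<close>
lemma nn_integral_one_minus_exp_powr:
  fixes \<alpha> m :: real
  assumes "1 < \<alpha>" "0 < m"
  shows "(\<integral>\<^sup>+t\<in>{0<..}. ennreal ((1 - exp (- ((m * t) powr \<alpha>))) / t\<^sup>2) \<partial>lborel)
     = ennreal (m * Gamma (1 - 1 / \<alpha>))"
proof -
  have exp_int: "(\<integral>\<^sup>+u. ennreal (exp (- u)) * indicator {0<..<b} u \<partial>lborel) = ennreal (1 - exp (- b))"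
    if "0 \<le> b" for b :: real
  proof -
    have "(\<integral>\<^sup>+u. ennreal (exp (- u)) * indicator {0..b} u \<partial>lborel) = ennreal (- exp (- b) - (- exp (- 0)))"
      using that by (intro nn_integral_FTC_Icc) (auto intro!: derivative_eq_intros)
    moreover have "(\<integral>\<^sup>+u. ennreal (exp (- u)) * indicator {0<..<b} u \<partial>lborel)
        = (\<integral>\<^sup>+u. ennreal (exp (- u)) * indicator {0..b} u \<partial>lborel)"
      using AE_lborel_singleton[of "0::real"] AE_lborel_singleton[of b]
      by (intro nn_integral_cong_AE) (auto simp: indicator_def)
    ultimately show ?thesis by simp
  qed
  \<comment> \<open>The region under the graph is rewritten as a half line in \<open>t\<close> for
    fixed \<open>u\<close>, ready for the exchange of integrals.\<close>
  have region: "0 < t \<and> u < (m * t) powr \<alpha> \<longleftrightarrow> u powr (1 / \<alpha>) / m < t" if "0 < u" for t u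
  proof -
    have "u < (m * t) powr \<alpha> \<longleftrightarrow> u powr (1 / \<alpha>) < m * t" if t: "0 < t"
    proof -
      have "u < (m * t) powr \<alpha> \<longleftrightarrow> (u powr (1 / \<alpha>)) powr \<alpha> < (m * t) powr \<alpha>"
        using \<open>0 < u\<close> assms by (simp add: powr_powr)
      also have "\<dots> \<longleftrightarrow> u powr (1 / \<alpha>) < m * t"
        using assms t powr_less_mono2[of \<alpha> "u powr (1 / \<alpha>)" "m * t"] powr_mono2[of \<alpha> "m * t" "u powr (1 / \<alpha>)"]
        by (auto simp: not_le[symmetric])
      finally show ?thesis .
    qed
    moreover have "0 < u powr (1 / \<alpha>) / m"
      using that assms by simp
    ultimately show ?thesis
      using assms by (smt (verit) divide_less_eq mult.commute)
  qed
  have "(\<integral>\<^sup>+t\<in>{0<..}. ennreal ((1 - exp (- ((m * t) powr \<alpha>))) / t\<^sup>2) \<partial>lborel)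
     = (\<integral>\<^sup>+t. (\<integral>\<^sup>+u. ennreal (1 / t\<^sup>2) * indicator {0<..} t * (ennreal (exp (- u)) * indicator {0<..<(m * t) powr \<alpha>} u) \<partial>lborel) \<partial>lborel)"
  proof (rule nn_integral_cong)
    fix t :: real
    have "ennreal ((1 - exp (- ((m * t) powr \<alpha>))) / t\<^sup>2) = ennreal (1 / t\<^sup>2) * ennreal (1 - exp (- ((m * t) powr \<alpha>)))"
      by (subst ennreal_mult[symmetric]) auto
    then show "ennreal ((1 - exp (- ((m * t) powr \<alpha>))) / t\<^sup>2) * indicator {0<..} t =
      (\<integral>\<^sup>+u. ennreal (1 / t\<^sup>2) * indicator {0<..} t * (ennreal (exp (- u)) * indicator {0<..<(m * t) powr \<alpha>} u) \<partial>lborel)"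
      by (subst nn_integral_cmult) (auto simp: exp_int mult_ac)
  qed
  also have "\<dots> = (\<integral>\<^sup>+t. (\<integral>\<^sup>+u. ennreal (1 / t\<^sup>2) * ennreal (exp (- u)) * indicator {0<..} u * indicator {u powr (1 / \<alpha>) / m <..} t \<partial>lborel) \<partial>lborel)"
  proof (intro nn_integral_cong)
    fix t u :: real
    show "ennreal (1 / t\<^sup>2) * indicator {0<..} t * (ennreal (exp (- u)) * indicator {0<..<(m * t) powr \<alpha>} u) =
      ennreal (1 / t\<^sup>2) * ennreal (exp (- u)) * indicator {0<..} u * indicator {u powr (1 / \<alpha>) / m <..} t"
      using region[of u t] by (auto simp: indicator_def)
  qed
  also have "\<dots> = (\<integral>\<^sup>+u. (\<integral>\<^sup>+t. ennreal (1 / t\<^sup>2) * ennreal (exp (- u)) * indicator {0<..} u * indicator {u powr (1 / \<alpha>) / m <..} t \<partial>lborel) \<partial>lborel)"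
  proof (rule lborel_pair.Fubini')
    have "(\<lambda>p. ennreal (1 / (snd p)\<^sup>2) * ennreal (exp (- fst p)) * indicator {0<..} (fst p) * indicator {p. fst p powr (1 / \<alpha>) / m < snd p} p)
        \<in> borel_measurable (lborel \<Otimes>\<^sub>M lborel)"
      by measurable
    then show "(\<lambda>(u, t). ennreal (1 / t\<^sup>2) * ennreal (exp (- u)) * indicator {0<..} u * indicator {u powr (1 / \<alpha>) / m <..} t)
        \<in> borel_measurable (lborel \<Otimes>\<^sub>M lborel)"
      by (simp add: case_prod_beta indicator_def cong: if_cong)
  qed
  \<comment> \<open>Integrating \<open>1 / t\<^sup>2\<close> beyond
    \<open>u powr (1 / \<alpha>) / m\<close> gives \<open>m * u powr (- 1 / \<alpha>)\<close>, hence
    the Gamma integrand at \<open>1 - 1 / \<alpha>\<close>, a positive argument since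
    \<open>1 < \<alpha>\<close>.\<close>
  also have "\<dots> = (\<integral>\<^sup>+u\<in>{0<..}. ennreal (m * (u powr ((1 - 1 / \<alpha>) - 1) * exp (- u))) \<partial>lborel)"
  proof (rule nn_integral_cong)
    fix u :: real
    let ?a = "u powr (1 / \<alpha>) / m"
    show "(\<integral>\<^sup>+t. ennreal (1 / t\<^sup>2) * ennreal (exp (- u)) * indicator {0<..} u * indicator {?a <..} t \<partial>lborel)
      = ennreal (m * (u powr ((1 - 1 / \<alpha>) - 1) * exp (- u))) * indicator {0<..} u"
    proof (cases "0 < u")
      case True
      have "(\<integral>\<^sup>+t. ennreal (1 / t\<^sup>2) * ennreal (exp (- u)) * indicator {0<..} u * indicator {?a <..} t \<partial>lborel)
        = (\<integral>\<^sup>+t. ennreal (exp (- u)) * (ennreal (1 / t\<^sup>2) * indicator {?a ..} t) \<partial>lborel)"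
        using AE_lborel_singleton[of ?a] True
        by (intro nn_integral_cong_AE) (auto simp: indicator_def mult_ac)
      also have "\<dots> = ennreal (exp (- u)) * ennreal (1 / ?a)"
        using True assms by (subst nn_integral_cmult) (auto simp: nn_integral_inverse_square_tail)
      also have "\<dots> = ennreal (m * (u powr ((1 - 1 / \<alpha>) - 1) * exp (- u)))"
        using assms by (subst ennreal_mult[symmetric]) (auto simp: powr_minus field_simps)
      finally show ?thesis using True by simp
    qed simp
  qed
  also have "\<dots> = (\<integral>\<^sup>+u. ennreal m * (ennreal (u powr ((1 - 1 / \<alpha>) - 1) * exp (- u)) * indicator {0<..} u) \<partial>lborel)"
    using assms by (intro nn_integral_cong) (auto simp: ennreal_mult mult_ac)
  also have "\<dots> = ennreal m * ennreal (Gamma (1 - 1 / \<alpha>))"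
    using assms using nn_integral_Gamma[of "1 - 1 / \<alpha>"] by (subst nn_integral_cmult) auto
  also have "\<dots> = ennreal (m * Gamma (1 - 1 / \<alpha>))"
    using assms by (subst ennreal_mult) (auto intro!: Gamma_real_nonneg)
  finally show ?thesis .
qed

text \<open>The cosine formula for the absolute value is integrated against \<open>\<mu>\<close>.
  After Tonelli only the real part of the characteristic function along the ray through
  \<open>\<xi>\<close> enters. Working with nonnegative integrals, finiteness of the first moment is
  part of the conclusion.\<close>

lemma nn_integral_abs_inner_of_char:
  fixes \<mu> :: "'a::euclidean_space measure" and \<alpha> m :: real
  assumes \<alpha>: "1 < \<alpha>" and \<mu>: "prob_space \<mu>" and [measurable_cong]: "sets \<mu> = sets borel" and m: "0 < m"
    and char: "\<And>t. 0 < t \<Longrightarrow> (LINT y|\<mu>. exp (\<i> * complex_of_real (y \<bullet> (t *\<^sub>R \<xi>)))) =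
           complex_of_real (exp (- ((m * t) powr \<alpha>)))"
  shows "(\<integral>\<^sup>+y. ennreal \<bar>y \<bullet> \<xi>\<bar> \<partial>\<mu>) = ennreal (2 / pi * Gamma (1 - 1 / \<alpha>) * m)"
proof -
  interpret prob_space \<mu> by fact
  interpret P: pair_sigma_finite \<mu> "lborel :: real measure" ..
  have one_minus_cos: "(\<integral>\<^sup>+y. ennreal ((1 - cos ((y \<bullet> \<xi>) * t)) / t\<^sup>2) \<partial>\<mu>)
      = ennreal ((1 - exp (- ((m * t) powr \<alpha>))) / t\<^sup>2)" if "0 < t" for t
  proof -
    have int: "integrable \<mu> (\<lambda>y. exp (\<i> * complex_of_real (y \<bullet> (t *\<^sub>R \<xi>))))"
      by (rule integrable_const_bound[where B=1]) auto
    have eq: "Re (exp (\<i> * complex_of_real (y \<bullet> (t *\<^sub>R \<xi>)))) = cos ((y \<bullet> \<xi>) * t)" for y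
      by (simp add: Re_exp mult.commute)
    have int': "integrable \<mu> (\<lambda>y. cos ((y \<bullet> \<xi>) * t))"
      by (rule integrable_const_bound[where B=1]) auto
    have "(LINT y|\<mu>. cos ((y \<bullet> \<xi>) * t)) = exp (- ((m * t) powr \<alpha>))"
      using integral_Re[OF int] char[OF that] unfolding eq by simp
    then have "(LINT y|\<mu>. (1 - cos ((y \<bullet> \<xi>) * t)) / t\<^sup>2) = (1 - exp (- ((m * t) powr \<alpha>))) / t\<^sup>2"
      using int' by (simp add: prob_space)
    then show ?thesis
      using int' by (subst nn_integral_eq_integral) auto
  qed
  have "ennreal (pi / 2) * (\<integral>\<^sup>+y. ennreal \<bar>y \<bullet> \<xi>\<bar> \<partial>\<mu>) = (\<integral>\<^sup>+y. ennreal (pi / 2 * \<bar>y \<bullet> \<xi>\<bar>) \<partial>\<mu>)"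
    by (subst nn_integral_cmult[symmetric]) (auto simp: ennreal_mult simp del: times_divide_eq_left)
  also have "\<dots> = (\<integral>\<^sup>+y. (\<integral>\<^sup>+t. ennreal ((1 - cos ((y \<bullet> \<xi>) * t)) / t\<^sup>2) * indicator {0<..} t \<partial>lborel) \<partial>\<mu>)"
    by (simp add: nn_integral_one_minus_cos)
  also have "\<dots> = (\<integral>\<^sup>+t. (\<integral>\<^sup>+y. ennreal ((1 - cos ((y \<bullet> \<xi>) * t)) / t\<^sup>2) * indicator {0<..} t \<partial>\<mu>) \<partial>lborel)"
    by (rule P.Fubini'[symmetric]) measurable
  also have "\<dots> = (\<integral>\<^sup>+t\<in>{0<..}. ennreal ((1 - exp (- ((m * t) powr \<alpha>))) / t\<^sup>2) \<partial>lborel)"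
    by (intro nn_integral_cong) (auto simp: one_minus_cos indicator_def)
  also have "\<dots> = ennreal (m * Gamma (1 - 1 / \<alpha>))"
    by (rule nn_integral_one_minus_exp_powr[OF \<alpha> m])
  finally have *: "ennreal (pi / 2) * (\<integral>\<^sup>+y. ennreal \<bar>y \<bullet> \<xi>\<bar> \<partial>\<mu>) = ennreal (m * Gamma (1 - 1 / \<alpha>))" .
  have "(\<integral>\<^sup>+y. ennreal \<bar>y \<bullet> \<xi>\<bar> \<partial>\<mu>) = ennreal (2 / pi) * (ennreal (pi / 2) * (\<integral>\<^sup>+y. ennreal \<bar>y \<bullet> \<xi>\<bar> \<partial>\<mu>))"
    by (simp add: mult.assoc[symmetric] ennreal_mult[symmetric])
  also have "\<dots> = ennreal (2 / pi * (m * Gamma (1 - 1 / \<alpha>)))"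
    unfolding * using m \<alpha> by (subst ennreal_mult) (auto intro!: mult_nonneg_nonneg Gamma_real_nonneg)
  finally show ?thesis by (simp add: mult_ac)
qed

section \<open>Norms, dual norms and their gradients\<close>

text \<open>Norms are a locale on functions because the stable norm and its dual live on the same
  type, beside the Euclidean norm.\<close>

locale vector_norm =
  fixes N :: "'a::euclidean_space \<Rightarrow> real"
  assumes triangle: "N (x + y) \<le> N x + N y"
    and scale: "N (c *\<^sub>R x) = \<bar>c\<bar> * N x"
    and pos: "x \<noteq> 0 \<Longrightarrow> 0 < N x"
begin

lemma zero [simp]: "N 0 = 0"
  using scale[of 0 0] by simp

lemma nonneg [simp]: "0 \<le> N x"
  using pos[of x] by (cases "x = 0") auto

lemma minus [simp]: "N (- x) = N x"
  using scale[of "- 1" x] by simp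

lemma diff_le: "N x - N y \<le> N (x - y)"
  using triangle[of "x - y" y] by simp

lemma abs_diff_le: "\<bar>N x - N y\<bar> \<le> N (x - y)"
  using diff_le[of x y] diff_le[of y x] minus[of "x - y"] by simp

lemma sum_le: "finite I \<Longrightarrow> N (\<Sum>i\<in>I. f i) \<le> (\<Sum>i\<in>I. N (f i))"
  by (induction I rule: finite_induct) (auto intro: order_trans[OF triangle])

lemma le_sum_Basis: "N x \<le> (\<Sum>b\<in>Basis. N b * \<bar>x \<bullet> b\<bar>)"
  using sum_le[of Basis "\<lambda>b. (x \<bullet> b) *\<^sub>R b"] by (simp add: euclidean_representation scale mult.commute)

lemma upper_bound: obtains C where "0 < C" "\<And>x. N x \<le> C * norm x"
proof
  have "0 \<le> (\<Sum>b\<in>Basis. N b)" by (simp add: sum_nonneg)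
  then show "0 < (\<Sum>b\<in>Basis. N b) + 1" by simp
  fix x :: 'a
  have "N x \<le> (\<Sum>b\<in>Basis. N b * norm x)"
    by (rule order_trans[OF le_sum_Basis]) (intro sum_mono mult_left_mono Basis_le_norm, auto)
  also have "\<dots> \<le> ((\<Sum>b\<in>Basis. N b) + 1) * norm x"
    by (simp add: sum_distrib_right[symmetric] distrib_right)
  finally show "N x \<le> ((\<Sum>b\<in>Basis. N b) + 1) * norm x" .
qed

lemma continuous [continuous_intros]:
  assumes "continuous_on S f"
  shows "continuous_on S (\<lambda>x. N (f x))"
proof -
  obtain C where C: "0 < C" "\<And>x. N x \<le> C * norm x" using upper_bound by blast
  have "C-lipschitz_on UNIV N"
    using C by (intro lipschitz_onI) (auto simp: dist_norm intro: order_trans[OF abs_diff_le])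
  then have "continuous_on UNIV N" by (rule lipschitz_on_continuous_on)
  then show ?thesis using assms by (rule continuous_on_compose2) auto
qed

lemma measurable [measurable]: "N \<in> borel_measurable borel"
  by (intro borel_measurable_continuous_onI continuous continuous_on_id)

lemma lower_bound: obtains c where "0 < c" "\<And>x. c * norm x \<le> N x"
proof -
  have ne: "sphere (0::'a) 1 \<noteq> {}" by simp
  obtain u where u: "u \<in> sphere 0 1" "\<And>y. y \<in> sphere 0 1 \<Longrightarrow> N u \<le> N y"
    using continuous_attains_inf[OF compact_sphere ne continuous[OF continuous_on_id]] by blast
  show ?thesis
  proof (rule that)
    show "0 < N u" using u(1) by (intro pos) auto
    fix x :: 'a
    show "N u * norm x \<le> N x"
    proof (cases "x = 0")
      case False
      then have "N u \<le> N (x /\<^sub>R norm x)" by (intro u(2)) simp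
      then show ?thesis using False by (simp add: scale field_simps)
    qed simp
  qed
qed

lemma closed_ball: "closed {x. N x \<le> r}"
  by (intro closed_Collect_le continuous_intros)

lemma compact_ball: "compact {x. N x \<le> r}"
proof -
  obtain c where c: "0 < c" "\<And>x. c * norm x \<le> N x" using lower_bound by blast
  have "bounded {x. N x \<le> r}"
  proof (rule boundedI)
    fix x assume "x \<in> {x. N x \<le> r}"
    then show "norm x \<le> r / c" using c(2)[of x] c(1) by (simp add: field_simps)
  qed
  then show ?thesis using closed_ball by (simp add: compact_eq_bounded_closed)
qed

end

text \<open>The formula of \<open>stable_dual_norm\<close> with an arbitrary function in place of
  the stable norm.\<close>

definition dual_norm :: "('a::euclidean_space \<Rightarrow> real) \<Rightarrow> 'a \<Rightarrow> real" where
  "dual_norm M x = (SUP z\<in>{z. M z \<le> 1}. \<bar>x \<bullet> z\<bar>)"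

section \<open>Duality between a norm and its dual norm\<close>

context vector_norm
begin

text \<open>The unit ball is compact, so the supremum is a maximum; passing from a maximizer
  \<open>w\<close> to \<open>- w\<close> if necessary removes the absolute value.\<close>

lemma dual_norm_attained: "\<exists>z. N z \<le> 1 \<and> x \<bullet> z = dual_norm N x"
  and inner_le_dual_norm: "N z \<le> 1 \<Longrightarrow> \<bar>x \<bullet> z\<bar> \<le> dual_norm N x"
proof -
  have "{z. N z \<le> 1} \<noteq> {}" using zero by (metis empty_iff mem_Collect_eq zero_le_one)
  moreover have "continuous_on {z. N z \<le> 1} (\<lambda>z. \<bar>x \<bullet> z\<bar>)" by (intro continuous_intros)
  ultimately obtain w where w: "N w \<le> 1" "\<And>z. N z \<le> 1 \<Longrightarrow> \<bar>x \<bullet> z\<bar> \<le> \<bar>x \<bullet> w\<bar>"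
    using continuous_attains_sup[OF compact_ball[of 1]] by blast
  then have eq: "dual_norm N x = \<bar>x \<bullet> w\<bar>"
    unfolding dual_norm_def by (intro cSup_eq_maximum) auto
  show "N z \<le> 1 \<Longrightarrow> \<bar>x \<bullet> z\<bar> \<le> dual_norm N x" using w eq by simp
  show "\<exists>z. N z \<le> 1 \<and> x \<bullet> z = dual_norm N x"
  proof (cases "0 \<le> x \<bullet> w")
    case True then show ?thesis using w eq by (intro exI[of _ w]) simp
  next
    case False then show ?thesis using w eq by (intro exI[of _ "- w"]) simp
  qed
qed

lemma vector_norm_dual_norm: "vector_norm (dual_norm N)"
proof
  fix x y :: 'a and c :: real
  obtain z where z: "N z \<le> 1" "(x + y) \<bullet> z = dual_norm N (x + y)" using dual_norm_attained by blast
  then show "dual_norm N (x + y) \<le> dual_norm N x + dual_norm N y"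
    using inner_le_dual_norm[OF z(1), of x] inner_le_dual_norm[OF z(1), of y] by (simp add: inner_add_left)
  show "dual_norm N (c *\<^sub>R x) = \<bar>c\<bar> * dual_norm N x"
  proof (rule antisym)
    obtain z where z: "N z \<le> 1" "(c *\<^sub>R x) \<bullet> z = dual_norm N (c *\<^sub>R x)" using dual_norm_attained by blast
    have "dual_norm N (c *\<^sub>R x) \<le> \<bar>c\<bar> * \<bar>x \<bullet> z\<bar>"
      using z(2) by (metis abs_ge_self abs_mult inner_scaleR_left)
    also have "\<dots> \<le> \<bar>c\<bar> * dual_norm N x"
      by (intro mult_left_mono inner_le_dual_norm z) simp
    finally show "dual_norm N (c *\<^sub>R x) \<le> \<bar>c\<bar> * dual_norm N x" .
    obtain w where w: "N w \<le> 1" "x \<bullet> w = dual_norm N x" using dual_norm_attained by blast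
    have "0 \<le> dual_norm N x" using inner_le_dual_norm[OF w(1), of x] w(2) by simp
    then show "\<bar>c\<bar> * dual_norm N x \<le> dual_norm N (c *\<^sub>R x)"
      using inner_le_dual_norm[OF w(1), of "c *\<^sub>R x"] w(2) by (simp add: abs_mult)
  qed
  show "0 < dual_norm N x" if "x \<noteq> 0"
  proof -
    have "N (x /\<^sub>R N x) \<le> 1" using pos[OF that] by (simp add: scale)
    from inner_le_dual_norm[OF this, of x] have "\<bar>(x \<bullet> x) / N x\<bar> \<le> dual_norm N x"
      by (simp add: divide_inverse mult.commute)
    moreover have "0 < (x \<bullet> x) / N x" using that pos[OF that] by simp
    ultimately show ?thesis by simp
  qed
qed

text \<open>The dual norm is attained without absolute value, so the one-sided inequalities that
  define the polar set already bound it.\<close>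

lemma polar_set_ball: "polar_set {z. N z \<le> 1} = {x. dual_norm N x \<le> 1}"
proof safe
  fix x assume "x \<in> polar_set {z. N z \<le> 1}"
  then show "dual_norm N x \<le> 1"
    using dual_norm_attained[of x] by (auto simp: polar_set_def)
next
  fix x assume "dual_norm N x \<le> 1"
  then show "x \<in> polar_set {z. N z \<le> 1}"
    using inner_le_dual_norm[of _ x] by (force simp: polar_set_def)
qed

end

text \<open>Here \<open>\<xi>\<close> is the gradient of \<open>N\<close> away from the origin.\<close>
locale smooth_norm = vector_norm N for N :: "'a::euclidean_space \<Rightarrow> real" +
  fixes \<xi> :: "'a \<Rightarrow> 'a"
  assumes inner_gradient: "x \<bullet> \<xi> x = N x"
    and inner_gradient_le: "v \<bullet> \<xi> x \<le> N v"
    and continuous_gradient: "continuous_on (- {0}) \<xi>"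
begin

text \<open>Continuity may fail at the origin, but one exceptional point does not affect Borel
  measurability.\<close>

lemma measurable_gradient [measurable]: "\<xi> \<in> borel_measurable borel"
  by (rule borel_measurable_continuous_countable_exceptions[of "{0}"]) (auto simp: continuous_gradient)

text \<open>The increment \<open>N (x + h) - N x\<close> lies between \<open>h \<bullet> \<xi> x\<close> and \<open>h \<bullet> \<xi> (x + h)\<close>.\<close>
lemma has_derivative_norm:
  assumes "x \<noteq> 0"
  shows "(N has_derivative (\<lambda>h. h \<bullet> \<xi> x)) (at x)"
proof -
  have "isCont \<xi> x"
    using continuous_gradient assms by (simp add: continuous_on_eq_continuous_at open_Compl)
  then have lim: "((\<lambda>h. norm (\<xi> (x + h) - \<xi> x)) \<longlongrightarrow> 0) (at 0)"
    by (simp add: isCont_iff LIM_zero tendsto_norm_zero)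
  have bound: "norm (N (x + h) - N x - h \<bullet> \<xi> x) / norm h \<le> norm (\<xi> (x + h) - \<xi> x)" for h
  proof (cases "h = 0")
    case False
    have "N x + h \<bullet> \<xi> x \<le> N (x + h)"
      using inner_gradient_le[of "x + h" x] by (simp add: inner_add_left inner_gradient)
    moreover have "N (x + h) - h \<bullet> \<xi> (x + h) \<le> N x"
      using inner_gradient_le[of x "x + h"] inner_gradient[of "x + h"] by (simp add: inner_add_left)
    ultimately have "norm (N (x + h) - N x - h \<bullet> \<xi> x) \<le> h \<bullet> (\<xi> (x + h) - \<xi> x)"
      by (simp add: inner_diff_right)
    also have "\<dots> \<le> norm h * norm (\<xi> (x + h) - \<xi> x)"
      by (rule norm_cauchy_schwarz)
    finally show ?thesis using False by (simp add: field_simps)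
  qed simp
  have "((\<lambda>h. norm (N (x + h) - N x - h \<bullet> \<xi> x) / norm h) \<longlongrightarrow> 0) (at 0)"
    by (rule tendsto_sandwich[OF _ _ tendsto_const lim]; intro always_eventually allI bound) simp
  then show ?thesis
    unfolding has_derivative_at by (simp add: bounded_linear_inner_left)
qed

end

section \<open>Strict convexity of a norm and smoothness of its dual\<close>

locale strictly_convex_norm = vector_norm M for M :: "'a::euclidean_space \<Rightarrow> real" +
  assumes strict: "M x = 1 \<Longrightarrow> M y = 1 \<Longrightarrow> x \<noteq> y \<Longrightarrow> M ((1/2) *\<^sub>R (x + y)) < 1"
begin

text \<open>For nonzero \<open>x\<close> the choice is determined, by
  \<open>maximizer_unique\<close>; at the origin it is some point of the unit ball.\<close>

definition dual_point :: "'a \<Rightarrow> 'a" where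
  "dual_point x = (SOME z. M z \<le> 1 \<and> x \<bullet> z = dual_norm M x)"

lemma dual_point: "M (dual_point x) \<le> 1" "x \<bullet> dual_point x = dual_norm M x"
  using someI_ex[OF dual_norm_attained[of x]] unfolding dual_point_def by auto

interpretation dual: vector_norm "dual_norm M"
  by (rule vector_norm_dual_norm)

text \<open>A maximizer with norm below 1 could be scaled out to the unit sphere, which would
  increase the positive value \<open>x \<bullet> z\<close>.\<close>

lemma norm_maximizer:
  assumes "x \<noteq> 0" "M z \<le> 1" "x \<bullet> z = dual_norm M x"
  shows "M z = 1"
proof (rule ccontr)
  assume "M z \<noteq> 1"
  then have lt: "M z < 1" using assms by simp
  have pos': "0 < dual_norm M x" using dual.pos[OF assms(1)] .
  then have "z \<noteq> 0" using assms(3) by auto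
  then have Mz: "0 < M z" by (rule pos)
  have "M (z /\<^sub>R M z) \<le> 1" using Mz by (simp add: scale)
  from inner_le_dual_norm[OF this, of x] have "\<bar>dual_norm M x / M z\<bar> \<le> dual_norm M x"
    using assms(3) by (simp add: divide_inverse mult.commute)
  then have "dual_norm M x \<le> dual_norm M x * M z" using Mz pos' by (simp add: field_simps)
  then show False using lt pos' by simp
qed

text \<open>The midpoint of two maximizers is again a maximizer, hence has norm 1; strict convexity
  forbids this unless they coincide.\<close>

lemma maximizer_unique:
  assumes "x \<noteq> 0" "M z \<le> 1" "x \<bullet> z = dual_norm M x" "M w \<le> 1" "x \<bullet> w = dual_norm M x"
  shows "z = w"
proof (rule ccontr)
  assume "z \<noteq> w"
  let ?m = "(1/2) *\<^sub>R (z + w)"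
  have "M ?m < 1" using assms \<open>z \<noteq> w\<close> by (intro strict norm_maximizer[of x])
  moreover have "x \<bullet> ?m = dual_norm M x" using assms by (simp add: inner_add_right)
  ultimately show False using norm_maximizer[OF assms(1), of ?m] by simp
qed

text \<open>Continuity comes from the closed graph theorem for maps into a compact set: by
  uniqueness of maximizers the graph is cut out by the closed condition
  \<open>x \<bullet> z = dual_norm M x\<close>.\<close>

lemma smooth_norm_dual_norm: "smooth_norm (dual_norm M) dual_point"
proof
  fix x v :: 'a
  show "x \<bullet> dual_point x = dual_norm M x" by (rule dual_point)
  show "v \<bullet> dual_point x \<le> dual_norm M v"
    using inner_le_dual_norm[OF dual_point(1)[of x], of v] by simp
next
  have graph: "(\<lambda>x. (x, dual_point x)) ` (- {0}) =
      ((- {0}) \<times> {z. M z \<le> 1}) \<inter> {p. fst p \<bullet> snd p = dual_norm M (fst p)}"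
    using dual_point maximizer_unique by (auto simp: image_iff)
  show "continuous_on (- {0}) dual_point"
  proof (subst continuous_closed_graph_eq[OF compact_ball[of 1]])
    show "dual_point \<in> (- {0}) \<rightarrow> {z. M z \<le> 1}" using dual_point(1) by auto
    have "closed {p. fst p \<bullet> snd p = dual_norm M (fst p)}"
      by (intro closed_Collect_eq continuous_intros dual.continuous)
    then show "closedin (top_of_set ((- {0}) \<times> {z. M z \<le> 1})) ((\<lambda>x. (x, dual_point x)) ` (- {0}))"
      unfolding graph by (rule closedin_closed_Int)
  qed
qed

end

section \<open>The divergence over the unit ball\<close>

lemma nn_integral_lborel_affine:
  fixes t :: "'a::euclidean_space" and f :: "'a \<Rightarrow> ennreal"
  assumes [measurable]: "f \<in> borel_measurable borel" and "c \<noteq> 0"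
  shows "(\<integral>\<^sup>+x. f x \<partial>lborel) = ennreal (\<bar>c\<bar> ^ DIM('a)) * (\<integral>\<^sup>+x. f (t + c *\<^sub>R x) \<partial>lborel)"
  by (subst lborel_affine[OF \<open>c \<noteq> 0\<close>, of t])
    (simp add: nn_integral_density nn_integral_distr nn_integral_cmult)

lemma integral_lborel_translation:
  fixes t :: "'a::euclidean_space" and f :: "'a \<Rightarrow> real"
  assumes [measurable]: "f \<in> borel_measurable borel"
  shows "(LINT x|lborel. f (t + x)) = (LINT x|lborel. f x)"
  by (subst (2) lborel_distr_plus[of t, symmetric], subst integral_distr) auto

lemma integrable_compact_support:
  fixes f :: "'a::euclidean_space \<Rightarrow> 'b::{banach, second_countable_topology}"
  assumes "continuous_on UNIV f" "compact S" "\<And>x. x \<notin> S \<Longrightarrow> f x = 0"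
  shows "integrable lborel f"
proof -
  have "integrable lborel (\<lambda>x. indicator S x *\<^sub>R f x)"
    using assms by (intro borel_integrable_compact) (auto intro: continuous_on_subset)
  moreover have "(\<lambda>x. indicator S x *\<^sub>R f x) = f"
    using assms(3) by (auto simp: indicator_def fun_eq_iff)
  ultimately show ?thesis by simp
qed

text \<open>A directional derivative in the sequential form that dominated convergence
  takes.\<close>

lemma has_derivative_imp_LIMSEQ:
  fixes f :: "'a::real_normed_vector \<Rightarrow> real"
  assumes "(f has_derivative D) (at x)"
  shows "(\<lambda>n. (f (x + inverse (real (Suc n)) *\<^sub>R v) - f x) / inverse (real (Suc n))) \<longlonglongrightarrow> D v"
proof -
  interpret D: bounded_linear D using assms by (rule has_derivative_bounded_linear)
  have "((\<lambda>t. f (x + t *\<^sub>R v)) has_derivative (\<lambda>t. D (t *\<^sub>R v))) (at 0)"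
    by (rule has_derivative_compose[where f="\<lambda>t. x + t *\<^sub>R v"])
      (auto intro!: derivative_eq_intros simp: assms)
  then have "((\<lambda>t. f (x + t *\<^sub>R v)) has_field_derivative D v) (at 0)"
    by (simp add: has_field_derivative_def D.scaleR mult_commute_abs)
  then have "((\<lambda>h. (f (x + h *\<^sub>R v) - f x) / h) \<longlongrightarrow> D v) (at 0)"
    by (simp add: DERIV_def)
  then show ?thesis
    using LIMSEQ_inverse_real_of_nat by (elim filterlim_compose) (auto simp: filterlim_at simp del: of_nat_Suc)
qed

text \<open>The complement of the support is open and the field is constant there, so the derivative
  vanishes off the same compact set; being continuous, it is bounded.\<close>

lemma C1_compact_supportE:
  fixes \<phi> :: "'a::euclidean_space \<Rightarrow> 'a"
  assumes "C1_compact_support \<phi>"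
  obtains \<phi>' :: "'a \<Rightarrow> 'a \<Rightarrow>\<^sub>L 'a" and S C where
    "\<forall>x. (\<phi> has_derivative blinfun_apply (\<phi>' x)) (at x)" "continuous_on UNIV \<phi>'"
    "compact S" "\<forall>x. x \<notin> S \<longrightarrow> \<phi> x = 0 \<and> \<phi>' x = 0" "\<forall>x. norm (\<phi>' x) \<le> C"
proof -
  define S where "S = closure {x. \<phi> x \<noteq> 0}"
  obtain \<phi>' :: "'a \<Rightarrow> 'a \<Rightarrow>\<^sub>L 'a" where
    \<phi>': "\<And>x. (\<phi> has_derivative blinfun_apply (\<phi>' x)) (at x)" "continuous_on UNIV \<phi>'" and S: "compact S"
    using assms unfolding C1_compact_support_def S_def by blast
  have zero: "\<phi> x = 0" if "x \<notin> S" for x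
    using that closure_subset[of "{x. \<phi> x \<noteq> 0}"] unfolding S_def by auto
  have zero': "\<phi>' x = 0" if "x \<notin> S" for x
  proof (rule blinfun_eqI)
    have "open (- S)" using S by (simp add: compact_imp_closed open_Compl)
    moreover have "((\<lambda>x. 0) has_derivative (\<lambda>x. 0)) (at x)" by simp
    ultimately have "(\<phi> has_derivative (\<lambda>x. 0)) (at x)"
      using that zero by (intro has_derivative_transform_within_open[of "\<lambda>x. 0" _ x UNIV "- S" \<phi>]) auto
    then have "blinfun_apply (\<phi>' x) = (\<lambda>x. 0)"
      using \<phi>'(1) has_derivative_unique by blast
    then show "blinfun_apply (\<phi>' x) h = blinfun_apply 0 h" for h by simp
  qed
  have "compact (\<phi>' ` S)"
    using \<phi>'(2) S by (intro compact_continuous_image) (auto intro: continuous_on_subset)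
  then obtain C where C: "\<And>x. x \<in> S \<Longrightarrow> norm (\<phi>' x) \<le> C"
    by (force dest!: compact_imp_bounded simp: bounded_iff)
  \<comment> \<open>\<open>C\<close> bounds the derivative only on \<open>S\<close>, and may be
    negative when \<open>S\<close> is empty.\<close>
  have "norm (\<phi>' x) \<le> max 0 C" for x
    using C[of x] zero'[of x] by (cases "x \<in> S") auto
  with \<phi>' S zero zero' show ?thesis by (intro that[of \<phi>' S "max 0 C"]) auto
qed

lemma divergence_eq:
  assumes "(\<phi> has_derivative D) (at x)"
  shows "divergence \<phi> x = (\<Sum>b\<in>Basis. D b \<bullet> b)"
  by (simp only: divergence_def frechet_derivative_at[OF assms, symmetric])

lemma C1_compact_support_divergence:
  assumes "C1_compact_support \<phi>"
  shows "continuous_on UNIV (divergence \<phi>)" "integrable lborel (divergence \<phi>)"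
proof -
  obtain \<phi>' S C where \<phi>: "\<forall>x. (\<phi> has_derivative blinfun_apply (\<phi>' x)) (at x)" "continuous_on UNIV \<phi>'"
    "compact S" "\<forall>x. x \<notin> S \<longrightarrow> \<phi> x = 0 \<and> \<phi>' x = 0" "\<forall>x. norm (\<phi>' x) \<le> C"
    by (rule C1_compact_supportE[OF assms])
  have eq: "divergence \<phi> = (\<lambda>x. \<Sum>b\<in>Basis. blinfun_apply (\<phi>' x) b \<bullet> b)"
    using divergence_eq \<phi>(1) by blast
  show "continuous_on UNIV (divergence \<phi>)"
    unfolding eq by (intro continuous_intros \<phi>)
  then show "integrable lborel (divergence \<phi>)"
    by (rule integrable_compact_support[OF _ \<phi>(3)]) (simp add: eq \<phi>(4))
qed

section \<open>Volumes of balls, and tent functions\<close>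

context vector_norm
begin

abbreviation unit_ball_volume :: real where
  "unit_ball_volume \<equiv> measure lborel {x. N x \<le> 1}"

lemma emeasure_ball:
  assumes "0 < r"
  shows "emeasure lborel {x. N x \<le> r} = ennreal (r ^ DIM('a) * unit_ball_volume)"
proof -
  have "emeasure lborel {x. N x \<le> r} = (\<integral>\<^sup>+x. indicator {x. N x \<le> r} x \<partial>lborel)"
    by (subst nn_integral_indicator) measurable
  also have "\<dots> = ennreal (\<bar>r\<bar> ^ DIM('a)) * (\<integral>\<^sup>+x. indicator {x. N x \<le> r} (0 + r *\<^sub>R x) \<partial>lborel)"
    using assms by (intro nn_integral_lborel_affine) auto
  also have "(\<integral>\<^sup>+x. indicator {x. N x \<le> r} (0 + r *\<^sub>R x) \<partial>lborel) = (\<integral>\<^sup>+x. indicator {x. N x \<le> 1} x \<partial>lborel)"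
    using assms by (intro nn_integral_cong) (auto simp: indicator_def scale field_simps)
  also have "\<dots> = emeasure lborel {x. N x \<le> 1}"
    by (subst nn_integral_indicator) measurable
  also have "\<dots> = ennreal unit_ball_volume"
    using emeasure_compact_finite[OF compact_ball[of 1]] by (intro emeasure_eq_ennreal_measure) auto
  finally show ?thesis using assms by (simp add: ennreal_mult)
qed

lemma measure_ball: "0 < r \<Longrightarrow> measure lborel {x. N x \<le> r} = r ^ DIM('a) * unit_ball_volume"
  by (rule measure_eq_emeasure_eq_ennreal[OF _ emeasure_ball]) auto

lemma fmeasurable_ball: "{x. N x \<le> r} \<in> fmeasurable lborel"
  using emeasure_compact_finite[OF compact_ball[of r]] by (intro fmeasurableI) auto

text \<open>The sphere lies in every shell \<open>r - e < N x \<le> r\<close>, and by scaling the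
  volume of the shell tends to 0 with \<open>e\<close>.\<close>

lemma AE_sphere:
  assumes "0 < r"
  shows "AE x in lborel. N x \<noteq> r"
proof -
  have le: "measure lborel {x. N x = r} \<le> r ^ DIM('a) * unit_ball_volume - (r - e) ^ DIM('a) * unit_ball_volume"
    if "0 < e" "e < r" for e
  proof -
    have "measure lborel {x. N x = r} \<le> measure lborel ({x. N x \<le> r} - {x. N x \<le> r - e})"
      using that fmeasurable_ball by (intro measure_mono_fmeasurable) (auto intro: fmeasurable.Diff)
    also have "\<dots> = measure lborel {x. N x \<le> r} - measure lborel {x. N x \<le> r - e}"
      using that fmeasurable_ball emeasure_compact_finite[OF compact_ball] by (intro measure_Diff) (auto simp: less_top)
    finally show ?thesis using that assms measure_ball[of r] measure_ball[of "r - e"] by simp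
  qed
  have "((\<lambda>e. r ^ DIM('a) * unit_ball_volume - (r - e) ^ DIM('a) * unit_ball_volume) \<longlongrightarrow>
      r ^ DIM('a) * unit_ball_volume - (r - 0) ^ DIM('a) * unit_ball_volume) (at_right 0)"
    by (intro tendsto_intros)
  then have "measure lborel {x. N x = r} \<le> r ^ DIM('a) * unit_ball_volume - (r - 0) ^ DIM('a) * unit_ball_volume"
    by (rule tendsto_lowerbound)
      (auto intro!: le eventually_at_rightI[of 0 r] assms simp: trivial_limit_at_right_real)
  then have "measure lborel {x. N x = r} = 0"
    using measure_nonneg[of lborel "{x. N x = r}"] by simp
  moreover have "{x. N x = r} \<in> fmeasurable lborel"
    by (rule fmeasurableI2[OF fmeasurable_ball[of r]]) auto
  ultimately have "emeasure lborel {x. N x = r} = 0"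
    by (simp add: emeasure_eq_measure2)
  then show ?thesis
    by (intro AE_I[where N="{x. N x = r}"]) auto
qed

text \<open>A cone over the ball of radius \<open>R\<close>: almost everywhere its gradient is
  \<open>- \<xi>\<close> inside the ball and 0 outside, and its superlevel sets at levels from 0 up
  to \<open>R\<close> are balls of \<open>N\<close>.\<close>

definition tent :: "real \<Rightarrow> 'a \<Rightarrow> real" where
  "tent R x = max 0 (R - N x)"

lemma continuous_tent [continuous_intros]: "continuous_on S f \<Longrightarrow> continuous_on S (\<lambda>x. tent R (f x))"
  unfolding tent_def by (intro continuous_intros)

lemma measurable_tent [measurable]: "tent R \<in> borel_measurable borel"
  by (intro borel_measurable_continuous_onI continuous_tent continuous_on_id)

lemma tent_eq_0: "x \<notin> {x. N x \<le> R} \<Longrightarrow> tent R x = 0"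
  by (simp add: tent_def)

lemma integrable_tent: "integrable lborel (tent R)"
  by (rule integrable_compact_support[OF continuous_tent[OF continuous_on_id] compact_ball tent_eq_0])

lemma tent_diff_le: "\<bar>tent R (x + h) - tent R x\<bar> \<le> N h"
  using abs_diff_le[of "x + h" x] unfolding tent_def by (simp add: max_def abs_if split: if_splits)

end

section \<open>Integration by parts against tents and the upper bound for the divergence\<close>

context smooth_norm
begin

lemma has_derivative_tent:
  assumes "x \<noteq> 0" "N x \<noteq> R"
  shows "(tent R has_derivative (\<lambda>h. - (indicator {x. N x < R} x * (h \<bullet> \<xi> x)))) (at x)"
proof (cases "N x < R")
  case True
  have "open {x. N x < R}" by (intro open_Collect_less continuous_intros)
  moreover have "((\<lambda>x. R - N x) has_derivative (\<lambda>h. - (h \<bullet> \<xi> x))) (at x)"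
    using has_derivative_norm[OF assms(1)] by (auto intro!: derivative_eq_intros)
  ultimately have "(tent R has_derivative (\<lambda>h. - (h \<bullet> \<xi> x))) (at x)"
    using True by (intro has_derivative_transform_within_open[of "\<lambda>x. R - N x" _ x UNIV "{x. N x < R}" "tent R"])
      (auto simp: tent_def)
  then show ?thesis using True by simp
next
  case False
  have "open {x. R < N x}" by (intro open_Collect_less continuous_intros)
  then have "(tent R has_derivative (\<lambda>h. 0)) (at x)"
    using False assms by (intro has_derivative_transform_within_open[of "\<lambda>x. 0" _ x UNIV "{x. R < N x}" "tent R"])
      (auto simp: tent_def)
  then show ?thesis using False by simp
qed

text \<open>Integration by parts for a function that is only Lipschitz. Translation invariance of
  Lebesgue measure moves difference quotients from the field to the tent, and dominated convergence
  passes to the limit on both sides.\<close>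

lemma integral_tent_divergence:
  assumes "C1_compact_support \<phi>" and R: "0 < R"
  shows "(LINT x|lborel. tent R x * divergence \<phi> x) = (LINT x|lborel. indicator {x. N x < R} x * (\<phi> x \<bullet> \<xi> x))"
    and "integrable lborel (\<lambda>x. indicator {x. N x < R} x * (\<phi> x \<bullet> \<xi> x))"
proof -
  obtain \<phi>' S C where \<phi>: "\<forall>x. (\<phi> has_derivative blinfun_apply (\<phi>' x)) (at x)"
    and cont': "continuous_on UNIV \<phi>'" and S: "compact S"
    and "\<forall>x. x \<notin> S \<longrightarrow> \<phi> x = 0 \<and> \<phi>' x = 0" and C: "\<forall>x. norm (\<phi>' x) \<le> C"
    by (rule C1_compact_supportE[OF assms(1)])
  then have zero: "x \<notin> S \<Longrightarrow> \<phi> x = 0" for x by blast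
  have deriv: "(\<phi> has_derivative blinfun_apply (\<phi>' x)) (at x)" for x using \<phi> by blast
  have cont: "continuous_on UNIV \<phi>"
    using deriv by (intro continuous_at_imp_continuous_on ballI has_derivative_continuous)
  have [measurable]: "\<phi> \<in> borel_measurable borel" "(\<lambda>x. blinfun_apply (\<phi>' x) b) \<in> borel_measurable borel" for b
    using cont cont' by (auto intro!: borel_measurable_continuous_onI continuous_intros)
  have lip: "norm (\<phi> x - \<phi> y) \<le> C * norm (x - y)" for x y
    using deriv C by (intro differentiable_bound[where S=UNIV and f'="\<lambda>x. blinfun_apply (\<phi>' x)"])
      (auto simp: norm_blinfun.rep_eq[symmetric])
  define e where "e n = inverse (real (Suc n))" for n
  have e: "0 < e n" for n by (simp add: e_def)
  have part: "(LINT x|lborel. tent R x * (blinfun_apply (\<phi>' x) b \<bullet> b))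
      = (LINT x|lborel. indicator {x. N x < R} x * ((\<phi> x \<bullet> b) * (b \<bullet> \<xi> x)))" (is ?eq)
    and int1: "integrable lborel (\<lambda>x. tent R x * (blinfun_apply (\<phi>' x) b \<bullet> b))"
    and int2: "integrable lborel (\<lambda>x. indicator {x. N x < R} x * ((\<phi> x \<bullet> b) * (b \<bullet> \<xi> x)))"
    if b: "b \<in> Basis" for b
  proof -
    \<comment> \<open>The quotient of \<open>\<phi>\<close> steps along \<open>b\<close> and that of
      the tent along \<open>- b\<close>; a translation by \<open>e n *\<^sub>R b\<close> identifies
      the two integrals.\<close>
    let ?p = "\<lambda>n x. tent R x * (((\<phi> (x + e n *\<^sub>R b) \<bullet> b) - (\<phi> x \<bullet> b)) / e n)"
    let ?q = "\<lambda>n x. (\<phi> x \<bullet> b) * ((tent R (x + e n *\<^sub>R (- b)) - tent R x) / e n)"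
    have eq: "(LINT x|lborel. ?p n x) = (LINT x|lborel. ?q n x)" for n
    proof -
      have i1: "integrable lborel (\<lambda>x. tent R x * (\<phi> (x + v) \<bullet> b))" for v
        by (rule integrable_compact_support[OF _ compact_ball[of R]])
          (auto intro!: continuous_intros continuous_on_compose2[OF cont] simp: tent_eq_0)
      have i2: "integrable lborel (\<lambda>x. tent R (x + v) * (\<phi> x \<bullet> b))" for v
        by (rule integrable_compact_support[OF _ S])
          (auto intro!: continuous_intros continuous_on_compose2[OF cont] simp: zero)
      \<comment> \<open>The summand \<open>x + 0\<close> keeps the unshifted term an instance of
        \<open>i1\<close> and \<open>i2\<close>.\<close>
      have "(LINT x|lborel. ?p n x) = (LINT x|lborel. (tent R x * (\<phi> (x + e n *\<^sub>R b) \<bullet> b) - tent R x * (\<phi> (x + 0) \<bullet> b)) / e n)"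
        by (intro Bochner_Integration.integral_cong) (auto simp: field_simps)
      also have "\<dots> = ((LINT x|lborel. tent R x * (\<phi> (x + e n *\<^sub>R b) \<bullet> b)) - (LINT x|lborel. tent R x * (\<phi> (x + 0) \<bullet> b))) / e n"
        using i1[of "e n *\<^sub>R b"] i1[of 0] by simp
      also have "(LINT x|lborel. tent R x * (\<phi> (x + e n *\<^sub>R b) \<bullet> b)) = (LINT x|lborel. tent R (x + e n *\<^sub>R (- b)) * (\<phi> x \<bullet> b))"
        using integral_lborel_translation[of "\<lambda>x. tent R (x + e n *\<^sub>R (- b)) * (\<phi> x \<bullet> b)" "e n *\<^sub>R b"]
        by (simp add: add.commute)
      also have "(\<dots> - (LINT x|lborel. tent R x * (\<phi> (x + 0) \<bullet> b))) / e n =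
          (LINT x|lborel. (tent R (x + e n *\<^sub>R (- b)) * (\<phi> x \<bullet> b) - tent R (x + 0) * (\<phi> x \<bullet> b)) / e n)"
        using i2[of "e n *\<^sub>R (- b)"] i2[of 0] by simp
      also have "\<dots> = (LINT x|lborel. ?q n x)"
        by (intro Bochner_Integration.integral_cong) (auto simp: field_simps)
      finally show ?thesis .
    qed
    have p_lim: "AE x in lborel. (\<lambda>n. ?p n x) \<longlonglongrightarrow> tent R x * (blinfun_apply (\<phi>' x) b \<bullet> b)"
    proof (rule AE_I2)
      fix x
      have "((\<lambda>x. \<phi> x \<bullet> b) has_derivative (\<lambda>h. blinfun_apply (\<phi>' x) h \<bullet> b)) (at x)"
        by (rule has_derivative_inner_left[OF deriv])
      from has_derivative_imp_LIMSEQ[OF this, of b]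
      show "(\<lambda>n. ?p n x) \<longlonglongrightarrow> tent R x * (blinfun_apply (\<phi>' x) b \<bullet> b)"
        unfolding e_def by (intro tendsto_mult tendsto_const)
    qed
    have p_bound: "AE x in lborel. norm (?p n x) \<le> tent R x * C" for n
    proof (rule AE_I2)
      fix x
      have "\<bar>(\<phi> (x + e n *\<^sub>R b) \<bullet> b) - (\<phi> x \<bullet> b)\<bar> \<le> norm (\<phi> (x + e n *\<^sub>R b) - \<phi> x)"
        using b by (simp add: inner_diff_left[symmetric] Basis_le_norm)
      also have "\<dots> \<le> C * e n"
        using lip[of "x + e n *\<^sub>R b" x] b e[of n] by simp
      finally have "\<bar>((\<phi> (x + e n *\<^sub>R b) \<bullet> b) - (\<phi> x \<bullet> b)) / e n\<bar> \<le> C"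
        using e[of n] by (simp add: abs_divide divide_le_eq)
      then show "norm (?p n x) \<le> tent R x * C"
        unfolding real_norm_def abs_mult by (intro mult_mono) (auto simp: tent_def)
    qed
    \<comment> \<open>Differentiability of the tent may fail at the origin and on the sphere of
      radius \<open>R\<close>, both null sets. The signs of the step \<open>- b\<close> and of the
      gradient \<open>- \<xi>\<close> cancel.\<close>
    have q_lim: "AE x in lborel. (\<lambda>n. ?q n x) \<longlonglongrightarrow> indicator {x. N x < R} x * ((\<phi> x \<bullet> b) * (b \<bullet> \<xi> x))"
      using AE_sphere[OF R] AE_lborel_singleton[of 0]
    proof eventually_elim
      case (elim x)
      have "(\<lambda>n. ?q n x) \<longlonglongrightarrow> (\<phi> x \<bullet> b) * - (indicator {x. N x < R} x * (- b \<bullet> \<xi> x))"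
        unfolding e_def using elim by (intro tendsto_mult tendsto_const has_derivative_imp_LIMSEQ has_derivative_tent)
      then show ?case by (simp add: mult_ac)
    qed
    have q_bound: "AE x in lborel. norm (?q n x) \<le> \<bar>\<phi> x \<bullet> b\<bar> * N b" for n
    proof (rule AE_I2)
      fix x
      have "\<bar>tent R (x + e n *\<^sub>R (- b)) - tent R x\<bar> \<le> e n * N b"
        using tent_diff_le[of R x "e n *\<^sub>R (- b)"] e[of n] by (simp only: scale minus)
      then have "\<bar>(tent R (x + e n *\<^sub>R (- b)) - tent R x) / e n\<bar> \<le> N b"
        using e[of n] by (simp add: abs_divide divide_le_eq mult.commute)
      then show "norm (?q n x) \<le> \<bar>\<phi> x \<bullet> b\<bar> * N b"
        unfolding real_norm_def abs_mult by (intro mult_left_mono) auto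
    qed
    have w1: "integrable lborel (\<lambda>x. tent R x * C)"
      using integrable_tent by simp
    have w2: "integrable lborel (\<lambda>x. \<bar>\<phi> x \<bullet> b\<bar> * N b)"
      by (rule integrable_compact_support[OF _ S]) (auto intro!: continuous_intros cont simp: zero)
    note D1 = integral_dominated_convergence[OF _ _ w1 p_lim p_bound]
      integrable_dominated_convergence[OF _ _ w1 p_lim p_bound]
    note D2 = integral_dominated_convergence[OF _ _ w2 q_lim q_bound]
      integrable_dominated_convergence[OF _ _ w2 q_lim q_bound]
    show "integrable lborel (\<lambda>x. tent R x * (blinfun_apply (\<phi>' x) b \<bullet> b))"
      by (rule D1(2)) measurable
    show "integrable lborel (\<lambda>x. indicator {x. N x < R} x * ((\<phi> x \<bullet> b) * (b \<bullet> \<xi> x)))"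
      by (rule D2(2)) measurable
    have "(\<lambda>n. LINT x|lborel. ?p n x) \<longlonglongrightarrow> (LINT x|lborel. tent R x * (blinfun_apply (\<phi>' x) b \<bullet> b))"
      by (rule D1(1)) measurable
    moreover have "(\<lambda>n. LINT x|lborel. ?q n x) \<longlonglongrightarrow> (LINT x|lborel. indicator {x. N x < R} x * ((\<phi> x \<bullet> b) * (b \<bullet> \<xi> x)))"
      by (rule D2(1)) measurable
    ultimately show ?eq
      unfolding eq by (rule LIMSEQ_unique)
  qed
  have eq1: "tent R x * divergence \<phi> x = (\<Sum>b\<in>Basis. tent R x * (blinfun_apply (\<phi>' x) b \<bullet> b))" for x
    by (simp add: divergence_eq[OF deriv] sum_distrib_left)
  have eq2: "indicator {x. N x < R} x * (\<phi> x \<bullet> \<xi> x) =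
      (\<Sum>b\<in>Basis. indicator {x. N x < R} x * ((\<phi> x \<bullet> b) * (b \<bullet> \<xi> x)))" for x
    by (simp add: euclidean_inner[of "\<phi> x" "\<xi> x"] sum_distrib_left inner_commute)
  show "(LINT x|lborel. tent R x * divergence \<phi> x) = (LINT x|lborel. indicator {x. N x < R} x * (\<phi> x \<bullet> \<xi> x))"
    unfolding eq1 eq2
    by (simp only: Bochner_Integration.integral_sum[OF int1] Bochner_Integration.integral_sum[OF int2] part cong: sum.cong)
  show "integrable lborel (\<lambda>x. indicator {x. N x < R} x * (\<phi> x \<bullet> \<xi> x))"
    unfolding eq2 by (rule Bochner_Integration.integrable_sum[OF int2])
qed

lemma integral_divergence_le:
  assumes \<phi>: "C1_compact_support \<phi>" and le: "\<And>x. N (\<phi> x) \<le> 1"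
  shows "(LINT x:{x. N x \<le> 1}|lborel. divergence \<phi> x) \<le> DIM('a) * unit_ball_volume"
proof -
  define e where "e n = inverse (real (Suc n))" for n
  have e: "0 < e n" for n by (simp add: e_def)
  have e_lim: "e \<longlonglongrightarrow> 0" unfolding e_def by (rule LIMSEQ_inverse_real_of_nat)
  \<comment> \<open>A difference quotient of tents in the radius: 1 on the unit ball, 0 where
    \<open>N x \<ge> 1 + e n\<close>, linear in \<open>N x\<close> between.\<close>
  define T where "T n x = (tent (1 + e n) x - tent 1 x) / e n" for n x
  note div = C1_compact_support_divergence[OF \<phi>]
  note [measurable] = borel_measurable_continuous_onI[OF div(1)]
  have int_ball: "(LINT x|lborel. indicator {x. N x < R} x) = R ^ DIM('a) * unit_ball_volume"
      "integrable lborel (indicator {x. N x < R} :: 'a \<Rightarrow> real)" if "0 < R" for R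
  proof -
    have "(LINT x|lborel. indicator {x. N x < R} x) = (LINT x|lborel. indicat_real {x. N x \<le> R} x)"
      using AE_sphere[OF that] by (intro integral_cong_AE) (auto simp: indicator_def)
    then show "(LINT x|lborel. indicator {x. N x < R} x) = R ^ DIM('a) * unit_ball_volume"
      using measure_ball[OF that] by simp
    have "{x. N x < R} \<in> fmeasurable lborel"
      by (rule fmeasurableI2[OF fmeasurable_ball[of R]]) auto
    then show "integrable lborel (indicator {x. N x < R} :: 'a \<Rightarrow> real)"
      by (simp add: integrable_indicator_iff fmeasurable_def)
  qed
  have bound: "(LINT x|lborel. T n x * divergence \<phi> x) \<le> ((1 + e n) ^ DIM('a) - 1) / e n * unit_ball_volume" for n
  proof -
    let ?I = "\<lambda>R x. indicat_real {x. N x < R} x"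
    have pos: "0 < 1 + e n" using e[of n] by simp
    have int: "integrable lborel (\<lambda>x. tent R x * divergence \<phi> x)" if "0 < R" for R
      by (rule integrable_compact_support[OF _ compact_ball[of R]]) (auto intro!: continuous_intros div(1) simp: tent_eq_0)
    have "(LINT x|lborel. T n x * divergence \<phi> x) =
        (LINT x|lborel. (tent (1 + e n) x * divergence \<phi> x - tent 1 x * divergence \<phi> x) / e n)"
      by (intro Bochner_Integration.integral_cong) (auto simp: T_def field_simps)
    also have "\<dots> = ((LINT x|lborel. ?I (1 + e n) x * (\<phi> x \<bullet> \<xi> x)) - (LINT x|lborel. ?I 1 x * (\<phi> x \<bullet> \<xi> x))) / e n"
      using int[of "1 + e n"] int[of 1] pos by (simp add: integral_tent_divergence(1)[OF \<phi>])
    also have "\<dots> = (LINT x|lborel. ?I (1 + e n) x * (\<phi> x \<bullet> \<xi> x) - ?I 1 x * (\<phi> x \<bullet> \<xi> x)) / e n"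
      using pos by (subst Bochner_Integration.integral_diff) (auto intro!: integral_tent_divergence(2)[OF \<phi>])
    \<comment> \<open>The indicators differ only on the shell \<open>1 \<le> N x < 1 + e n\<close>,
      so the bound is the volume of the shell divided by its thickness.\<close>
    also have "\<dots> \<le> (LINT x|lborel. ?I (1 + e n) x - ?I 1 x) / e n"
    proof (intro divide_right_mono integral_mono)
      fix x
      have "\<phi> x \<bullet> \<xi> x \<le> 1" using inner_gradient_le[of "\<phi> x" x] le[of x] by simp
      then show "?I (1 + e n) x * (\<phi> x \<bullet> \<xi> x) - ?I 1 x * (\<phi> x \<bullet> \<xi> x) \<le> ?I (1 + e n) x - ?I 1 x"
        using e[of n] by (auto simp: indicator_def)
    qed (use pos e[of n] in \<open>auto intro!: Bochner_Integration.integrable_diff integral_tent_divergence(2)[OF \<phi>] int_ball(2)\<close>)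
    also have "\<dots> = ((1 + e n) ^ DIM('a) - 1) / e n * unit_ball_volume"
      using pos int_ball by (simp add: left_diff_distrib)
    finally show ?thesis .
  qed
  have "(\<lambda>n. LINT x|lborel. T n x * divergence \<phi> x) \<longlonglongrightarrow> (LINT x|lborel. indicator {x. N x \<le> 1} x * divergence \<phi> x)"
  proof (rule integral_dominated_convergence[where w="\<lambda>x. \<bar>divergence \<phi> x\<bar>"])
    show "AE x in lborel. (\<lambda>n. T n x * divergence \<phi> x) \<longlonglongrightarrow> indicator {x. N x \<le> 1} x * divergence \<phi> x"
    proof (rule AE_I2)
      fix x
      have "(\<lambda>n. T n x) \<longlonglongrightarrow> indicator {x. N x \<le> 1} x"
      proof (cases "N x \<le> 1")
        case True
        then have "T n x = 1" for n using e[of n] by (simp add: T_def tent_def)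
        then show ?thesis using True by simp
      next
        case False
        then have "\<forall>\<^sub>F n in sequentially. e n < N x - 1"
          using e_lim by (intro order_tendstoD) auto
        then have "\<forall>\<^sub>F n in sequentially. T n x = 0"
          by eventually_elim (use False in \<open>simp add: T_def tent_def\<close>)
        then show ?thesis using False by (simp add: tendsto_eventually)
      qed
      then show "(\<lambda>n. T n x * divergence \<phi> x) \<longlonglongrightarrow> indicator {x. N x \<le> 1} x * divergence \<phi> x"
        by (intro tendsto_mult tendsto_const)
    qed
    show "AE x in lborel. norm (T n x * divergence \<phi> x) \<le> \<bar>divergence \<phi> x\<bar>" for n
    proof (rule AE_I2)
      fix x
      have "0 \<le> T n x" "T n x \<le> 1"
        using e[of n] by (auto simp: T_def tent_def divide_le_eq)
      then show "norm (T n x * divergence \<phi> x) \<le> \<bar>divergence \<phi> x\<bar>"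
        by (simp add: abs_mult mult_left_le_one_le)
    qed
    show "integrable lborel (\<lambda>x. \<bar>divergence \<phi> x\<bar>)" using div(2) by simp
  qed (auto simp: T_def)
  moreover have "(\<lambda>n. ((1 + e n) ^ DIM('a) - 1) / e n * unit_ball_volume) \<longlonglongrightarrow> DIM('a) * unit_ball_volume"
  proof (intro tendsto_mult tendsto_const)
    \<comment> \<open>The factor \<open>DIM('a)\<close> is the derivative of the volume scaling
      \<open>r ^ DIM('a)\<close> at \<open>r = 1\<close>.\<close>
    have "((\<lambda>x::real. x ^ DIM('a)) has_real_derivative DIM('a)) (at 1)"
      by (auto intro!: derivative_eq_intros)
    then have "((\<lambda>h. ((1 + h) ^ DIM('a) - 1) / h) \<longlongrightarrow> real DIM('a)) (at 0)"
      by (simp add: DERIV_def)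
    then show "(\<lambda>n. ((1 + e n) ^ DIM('a) - 1) / e n) \<longlonglongrightarrow> real DIM('a)"
      using e_lim e by (elim filterlim_compose) (auto simp: filterlim_at less_imp_neq[symmetric])
  qed
  ultimately have "(LINT x|lborel. indicator {x. N x \<le> 1} x * divergence \<phi> x) \<le> DIM('a) * unit_ball_volume"
    by (rule LIMSEQ_le) (use bound in blast)
  then show ?thesis by (simp add: set_lebesgue_integral_def)
qed

end

section \<open>The perimeter of the unit ball\<close>

text \<open>Squaring the positive part smooths its corner; the cut-off below is composed of two such
  squares.\<close>

lemma DERIV_max_0_power2:
  "((\<lambda>t::real. (max 0 t)\<^sup>2) has_real_derivative 2 * max 0 t) (at t)"
proof -
  consider "t < 0" | "t > 0" | "t = 0" by linarith
  then show ?thesis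
  proof cases
    case 1
    have "((\<lambda>t::real. 0) has_real_derivative 2 * max 0 t) (at t)" using 1 by simp
    then show ?thesis
      by (rule has_field_derivative_transform_within_open[where S="{..<0}"]) (use 1 in auto)
  next
    case 2
    have "((\<lambda>t::real. t\<^sup>2) has_real_derivative 2 * max 0 t) (at t)"
      using 2 by (auto intro!: derivative_eq_intros)
    then show ?thesis
      by (rule has_field_derivative_transform_within_open[where S="{0<..}"]) (use 2 in auto)
  next
    case 3
    have "((\<lambda>h::real. max 0 h) \<longlongrightarrow> max 0 0) (at 0)"
      by (intro tendsto_intros)
    moreover have "(max 0 h)\<^sup>2 / h = max 0 h" if "h \<noteq> 0" for h :: real
      using that by (simp add: max_def power2_eq_square)
    ultimately have "((\<lambda>h::real. (max 0 h)\<^sup>2 / h) \<longlongrightarrow> 0) (at 0)"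
      by (subst filterlim_cong[OF refl refl, of _ "\<lambda>h. max 0 h"]) (auto simp: eventually_at_filter)
    then show ?thesis
      using 3 by (simp add: DERIV_def)
  qed
qed

text \<open>For positive \<open>\<delta>\<close> this descends from 1 at \<open>r = 1\<close> to 0
  at \<open>r = 1 + \<delta>\<close>. The inner square makes the transition C1 at
  \<open>r = 1\<close>, the outer one at \<open>r = 1 + \<delta>\<close>.\<close>

definition cutoff :: "real \<Rightarrow> real \<Rightarrow> real" where
  "cutoff \<delta> r = (max 0 (1 - (max 0 ((r - 1) / \<delta>))\<^sup>2))\<^sup>2"

definition cutoff' :: "real \<Rightarrow> real \<Rightarrow> real" where
  "cutoff' \<delta> r = 2 * max 0 (1 - (max 0 ((r - 1) / \<delta>))\<^sup>2) * (- (2 * max 0 ((r - 1) / \<delta>) * (1 / \<delta>)))"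

lemma DERIV_cutoff: "(cutoff \<delta> has_real_derivative cutoff' \<delta> r) (at r)"
proof -
  have "((\<lambda>r. r - 1) has_real_derivative 1) (at r)"
    by (auto intro!: derivative_eq_intros)
  then have "((\<lambda>r. (r - 1) / \<delta>) has_real_derivative 1 / \<delta>) (at r)"
    by (rule DERIV_cdivide)
  then have "((\<lambda>r. (max 0 ((r - 1) / \<delta>))\<^sup>2) has_real_derivative 2 * max 0 ((r - 1) / \<delta>) * (1 / \<delta>)) (at r)"
    by (rule DERIV_chain2[OF DERIV_max_0_power2])
  then have "((\<lambda>r. 1 - (max 0 ((r - 1) / \<delta>))\<^sup>2) has_real_derivative - (2 * max 0 ((r - 1) / \<delta>) * (1 / \<delta>))) (at r)"
    using DERIV_diff[OF DERIV_const] by fastforce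
  then show ?thesis
    unfolding cutoff_def[abs_def] cutoff'_def by (rule DERIV_chain2[OF DERIV_max_0_power2])
qed

lemma cutoff_bounds:
  assumes "0 < \<delta>"
  shows "r \<le> 1 \<Longrightarrow> cutoff \<delta> r = 1" "1 + \<delta> \<le> r \<Longrightarrow> cutoff \<delta> r = 0" "0 \<le> cutoff \<delta> r" "cutoff \<delta> r \<le> 1"
    "r \<le> 1 \<Longrightarrow> cutoff' \<delta> r = 0"
proof -
  show "r \<le> 1 \<Longrightarrow> cutoff \<delta> r = 1" "r \<le> 1 \<Longrightarrow> cutoff' \<delta> r = 0"
    using assms by (simp_all add: cutoff_def cutoff'_def max_absorb1 divide_le_0_iff)
  show "0 \<le> cutoff \<delta> r" by (simp add: cutoff_def)
  show "cutoff \<delta> r \<le> 1" unfolding cutoff_def by (intro power_le_one) auto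
  show "cutoff \<delta> r = 0" if "1 + \<delta> \<le> r"
  proof -
    have "1 \<le> (r - 1) / \<delta>" using that assms by (simp add: le_divide_eq)
    then have "1 \<le> (max 0 ((r - 1) / \<delta>))\<^sup>2" by (intro one_le_power) auto
    then show ?thesis by (simp add: cutoff_def)
  qed
qed

context smooth_norm
begin

text \<open>\<open>N\<close> need not be differentiable at the origin, but near it the cut-off is 1
  and the field is the identity. Elsewhere the product and chain rules apply.\<close>

lemma has_derivative_cutoff_scaleR:
  assumes "0 < \<delta>"
  shows "((\<lambda>x. cutoff \<delta> (N x) *\<^sub>R x) has_derivative
     (\<lambda>h. cutoff \<delta> (N x) *\<^sub>R h + (cutoff' \<delta> (N x) * (h \<bullet> \<xi> x)) *\<^sub>R x)) (at x)"
proof (cases "x = 0")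
  case True
  have "open {x. N x < 1}" by (intro open_Collect_less continuous_intros)
  then have "((\<lambda>x. cutoff \<delta> (N x) *\<^sub>R x) has_derivative (\<lambda>h. h)) (at x)"
    using True cutoff_bounds(1)[OF assms]
    by (intro has_derivative_transform_within_open[of "\<lambda>x. x" _ x UNIV "{x. N x < 1}" "\<lambda>x. cutoff \<delta> (N x) *\<^sub>R x"]) auto
  then show ?thesis using True assms by (simp add: cutoff_bounds)
next
  case False
  have "((\<lambda>x. cutoff \<delta> (N x)) has_derivative (\<lambda>h. cutoff' \<delta> (N x) * (h \<bullet> \<xi> x))) (at x)"
    by (rule has_derivative_compose[OF has_derivative_norm[OF False]])
      (rule DERIV_cutoff[unfolded has_field_derivative_def])
  from has_derivative_scaleR[OF this has_derivative_ident] show ?thesis .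
qed

lemma C1_compact_support_cutoff:
  assumes "0 < \<delta>"
  shows "C1_compact_support (\<lambda>x. c *\<^sub>R cutoff \<delta> (N x) *\<^sub>R x)"
proof -
  define D where "D x h = c *\<^sub>R (cutoff \<delta> (N x) *\<^sub>R h + (cutoff' \<delta> (N x) * (h \<bullet> \<xi> x)) *\<^sub>R x)" for x h
  have deriv: "((\<lambda>x. c *\<^sub>R cutoff \<delta> (N x) *\<^sub>R x) has_derivative D x) (at x)" for x
    unfolding D_def by (intro has_derivative_scaleR_right has_derivative_cutoff_scaleR assms)
  have apply_D: "blinfun_apply (Blinfun (D x)) = D x" for x
    by (rule bounded_linear_Blinfun_apply[OF has_derivative_bounded_linear[OF deriv]])
  have cutoff_cont: "continuous_on S (\<lambda>x. cutoff \<delta> (f x))" "continuous_on S (\<lambda>x. cutoff' \<delta> (f x))"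
    if "continuous_on S f" for S :: "'a set" and f
    unfolding cutoff_def cutoff'_def divide_inverse by (intro continuous_intros that)+
  \<comment> \<open>The possible discontinuity of \<open>\<xi>\<close> at the origin is hidden by
    \<open>cutoff'\<close>, which vanishes where \<open>N x < 1\<close>; continuity is glued from
    two open sets.\<close>
  have "continuous_on UNIV (\<lambda>x. cutoff' \<delta> (N x) * (h \<bullet> \<xi> x))" for h
  proof -
    have "continuous_on {x. N x < 1} (\<lambda>x. cutoff' \<delta> (N x) * (h \<bullet> \<xi> x))"
      by (rule continuous_on_eq[OF continuous_on_const[of _ 0]]) (auto simp: cutoff_bounds assms)
    moreover have "continuous_on (- {0}) (\<lambda>x. cutoff' \<delta> (N x) * (h \<bullet> \<xi> x))"
      by (intro continuous_intros cutoff_cont continuous_gradient)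
    moreover have "open {x. N x < 1}" by (intro open_Collect_less continuous_intros)
    ultimately have "continuous_on ({x. N x < 1} \<union> - {0}) (\<lambda>x. cutoff' \<delta> (N x) * (h \<bullet> \<xi> x))"
      by (intro continuous_on_open_Un) auto
    moreover have "{x. N x < 1} \<union> - {0} = UNIV" by auto
    ultimately show ?thesis by simp
  qed
  then have "continuous_on UNIV (\<lambda>x. D x h)" for h
    unfolding D_def
    by (intro continuous_on_scaleR continuous_on_add continuous_on_const continuous_on_id cutoff_cont continuous)
  then have "continuous_on UNIV (\<lambda>x. Blinfun (D x))"
    by (intro continuous_on_blinfun_componentwise) (simp add: apply_D)
  moreover have "compact (closure {x. c *\<^sub>R cutoff \<delta> (N x) *\<^sub>R x \<noteq> 0})"
  proof -
    have "{x. c *\<^sub>R cutoff \<delta> (N x) *\<^sub>R x \<noteq> 0} \<subseteq> {x. N x \<le> 1 + \<delta>}"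
      using cutoff_bounds(2)[OF assms] by (auto intro: ccontr simp: not_le dest: less_imp_le)
    then show ?thesis
      unfolding compact_closure by (rule bounded_subset[OF compact_imp_bounded[OF compact_ball]])
  qed
  ultimately show ?thesis
    unfolding C1_compact_support_def
    by (intro conjI exI[of _ "\<lambda>x. Blinfun (D x)"] allI) (simp_all only: apply_D deriv)
qed

text \<open>The vector field \<open>(1 - \<delta>) x\<close> is cut off between the levels \<open>1\<close> and \<open>1 + \<delta>\<close> of \<open>N\<close>, so that its
  values stay in the unit ball because \<open>(1 - \<delta>) (1 + \<delta>) \<le> 1\<close>.\<close>
lemma integral_divergence_attained:
  assumes "0 < \<delta>" "\<delta> < 1"
  shows "\<exists>\<phi>. C1_compact_support \<phi> \<and> (\<forall>x. N (\<phi> x) \<le> 1) \<and>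
    (LINT x:{x. N x \<le> 1}|lborel. divergence \<phi> x) = (1 - \<delta>) * (DIM('a) * unit_ball_volume)"
proof (intro exI conjI allI)
  let ?\<phi> = "\<lambda>x. (1 - \<delta>) *\<^sub>R cutoff \<delta> (N x) *\<^sub>R x"
  show "C1_compact_support ?\<phi>"
    by (rule C1_compact_support_cutoff[OF assms(1)])
  show "N (?\<phi> x) \<le> 1" for x
  proof (cases "N x \<le> 1 + \<delta>")
    case True
    have "N (?\<phi> x) = (1 - \<delta>) * (cutoff \<delta> (N x) * N x)"
      using assms cutoff_bounds(3)[OF assms(1)] by (simp add: scale)
    also have "\<dots> \<le> (1 - \<delta>) * (1 * (1 + \<delta>))"
      using assms True cutoff_bounds(3,4)[OF assms(1)] by (intro mult_left_mono mult_mono) auto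
    also have "\<dots> \<le> 1" by (simp add: algebra_simps)
    finally show ?thesis .
  next
    case False
    then show ?thesis using assms by (simp add: cutoff_bounds)
  qed
  \<comment> \<open>\<open>cutoff'\<close> vanishes also at level 1, so on the whole closed ball the
    derivative is \<open>1 - \<delta>\<close> times the identity, with trace
    \<open>(1 - \<delta>) * DIM('a)\<close>.\<close>
  have div: "divergence ?\<phi> x = (1 - \<delta>) * DIM('a)" if "N x \<le> 1" for x
    using divergence_eq[OF has_derivative_scaleR_right[OF has_derivative_cutoff_scaleR[OF assms(1)]], of "1 - \<delta>" x]
      that assms by (simp add: cutoff_bounds)
  have "(LINT x:{x. N x \<le> 1}|lborel. divergence ?\<phi> x) = (LINT x:{x. N x \<le> 1}|lborel. (1 - \<delta>) * DIM('a))"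
    using div by (intro set_lebesgue_integral_cong) auto
  then show "(LINT x:{x. N x \<le> 1}|lborel. divergence ?\<phi> x) = (1 - \<delta>) * (DIM('a) * unit_ball_volume)"
    by (simp add: set_lebesgue_integral_def)
qed

lemma perimeter_unit_ball:
  "(SUP \<phi>\<in>{\<phi>. C1_compact_support \<phi> \<and> (\<forall>x. N (\<phi> x) \<le> 1)}. ereal (LINT x:{x. N x \<le> 1}|lborel. divergence \<phi> x))
    = ereal (DIM('a) * unit_ball_volume)"
proof (rule antisym)
  show "(SUP \<phi>\<in>{\<phi>. C1_compact_support \<phi> \<and> (\<forall>x. N (\<phi> x) \<le> 1)}. ereal (LINT x:{x. N x \<le> 1}|lborel. divergence \<phi> x))
    \<le> ereal (DIM('a) * unit_ball_volume)"
    by (intro SUP_least) (auto intro: integral_divergence_le)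
next
  let ?S = "SUP \<phi>\<in>{\<phi>. C1_compact_support \<phi> \<and> (\<forall>x. N (\<phi> x) \<le> 1)}. ereal (LINT x:{x. N x \<le> 1}|lborel. divergence \<phi> x)"
  have le: "ereal ((1 - \<delta>) * (DIM('a) * unit_ball_volume)) \<le> ?S" if \<delta>: "0 < \<delta>" "\<delta> < 1" for \<delta>
  proof -
    obtain \<phi> where \<phi>: "C1_compact_support \<phi>" "\<forall>x. N (\<phi> x) \<le> 1"
      "(LINT x:{x. N x \<le> 1}|lborel. divergence \<phi> x) = (1 - \<delta>) * (DIM('a) * unit_ball_volume)"
      using integral_divergence_attained[OF \<delta>] by blast
    then show ?thesis by (intro SUP_upper2[of \<phi>]) auto
  qed
  have "((\<lambda>\<delta>. ereal ((1 - \<delta>) * (DIM('a) * unit_ball_volume))) \<longlongrightarrow> ereal ((1 - 0) * (DIM('a) * unit_ball_volume))) (at_right 0)"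
    by (intro tendsto_intros)
  then have "ereal ((1 - 0) * (DIM('a) * unit_ball_volume)) \<le> ?S"
    by (rule tendsto_upperbound) (auto intro!: le eventually_at_rightI[of 0 1])
  then show "ereal (DIM('a) * unit_ball_volume) \<le> ?S" by simp
qed

end

section \<open>The heat content of the unit ball\<close>

text \<open>Fekete's lemma at the origin: the limit is the supremum of the quotients.\<close>
lemma subadditive_quotient_tendsto:
  fixes h :: "real \<Rightarrow> real"
  assumes add: "\<And>s t. 0 \<le> s \<Longrightarrow> 0 \<le> t \<Longrightarrow> h (s + t) \<le> h s + h t"
    and bound: "\<And>s. 0 \<le> s \<Longrightarrow> h s \<le> C * s" and nonneg: "\<And>s. 0 \<le> h s"
  obtains L where "((\<lambda>s. h s / s) \<longlongrightarrow> L) (at_right 0)"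
proof -
  define L where "L = (SUP s\<in>{0<..}. h s / s)"
  have quot: "h s / s \<le> C" if "0 < s" for s
    using bound[of s] that by (simp add: divide_le_eq)
  have bdd: "bdd_above ((\<lambda>s. h s / s) ` {0<..})"
    using quot by (intro bdd_aboveI2) auto
  have mult: "h (real n * s) \<le> real n * h s" if "0 \<le> s" for n s
  proof (induction n)
    case 0 show ?case using bound[of 0] by simp
  next
    case (Suc n)
    have "h (real (Suc n) * s) \<le> h s + h (real n * s)"
      using add[of s "real n * s"] that by (simp add: algebra_simps)
    with Suc show ?case by (simp add: algebra_simps)
  qed
  have "((\<lambda>s. h s / s) \<longlongrightarrow> L) (at_right 0)"
  proof (rule order_tendstoI)
    fix a assume "L < a"
    show "\<forall>\<^sub>F s in at_right 0. h s / s < a"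
      using eventually_at_right_less[of 0]
    proof eventually_elim
      case (elim s)
      then have "h s / s \<le> L" unfolding L_def by (intro cSUP_upper bdd) auto
      with \<open>L < a\<close> show ?case by simp
    qed
  next
    fix a assume "a < L"
    then obtain u where u: "0 < u" "a < h u / u"
      unfolding L_def using bdd by (subst (asm) less_cSUP_iff) auto
    have "((\<lambda>s. (h u - C * s) / u) \<longlongrightarrow> (h u - C * 0) / u) (at_right 0)"
      using u by (intro tendsto_intros) auto
    then have "\<forall>\<^sub>F s in at_right 0. a < (h u - C * s) / u"
      using u by (intro order_tendstoD) auto
    then show "\<forall>\<^sub>F s in at_right 0. a < h s / s"
      using eventually_at_right_less[of 0]
    proof eventually_elim
      case (elim s)
      \<comment> \<open>Division with remainder of the nearly optimal \<open>u\<close> by the small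
        \<open>s\<close>; subadditivity is applied to \<open>n\<close> steps of length
        \<open>s\<close> and one remainder.\<close>
      define n where "n = nat \<lfloor>u / s\<rfloor>"
      define r where "r = u - real n * s"
      have n: "real n \<le> u / s" "u / s < real n + 1"
        using u elim unfolding n_def by auto
      have r: "0 \<le> r" "r \<le> s" using n elim by (simp_all add: r_def field_simps)
      have "h u \<le> h (real n * s) + h r"
        using add[of "real n * s" r] r elim by (simp add: r_def)
      also have "\<dots> \<le> real n * h s + C * r"
        using mult[of s n] bound[of r] r elim by simp
      \<comment> \<open>\<open>0 \<le> C\<close>, from the quotient bound at 1, allows
        \<open>r\<close> to be enlarged to \<open>s\<close>.\<close>
      also have "\<dots> \<le> u / s * h s + C * s"
        using n(1) r nonneg[of s] quot[of 1] nonneg[of 1] elim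
        by (intro add_mono mult_right_mono mult_left_mono) auto
      finally have "(h u - C * s) / u \<le> h s / s"
        using u elim by (simp add: field_simps)
      with elim show ?case by simp
    qed
  qed
  then show ?thesis by (rule that)
qed

section \<open>Volume that a translation moves out of the unit ball\<close>

context smooth_norm
begin

text \<open>\<open>N\<close> is even, so the chain rule and uniqueness of derivatives make its
  gradient odd.\<close>

lemma gradient_minus:
  assumes "x \<noteq> 0"
  shows "\<xi> (- x) = - \<xi> x"
proof -
  have "((\<lambda>x. N (- x)) has_derivative (\<lambda>h. (- h) \<bullet> \<xi> (- x))) (at x)"
    by (rule has_derivative_compose[where f=uminus, OF _ has_derivative_norm])
      (use assms in \<open>auto intro!: derivative_eq_intros\<close>)
  then have "(N has_derivative (\<lambda>h. (- h) \<bullet> \<xi> (- x))) (at x)" by simp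
  with has_derivative_norm[OF assms] have "(\<lambda>h. h \<bullet> \<xi> x) = (\<lambda>h. (- h) \<bullet> \<xi> (- x))"
    by (rule has_derivative_unique)
  from fun_cong[OF this] have "h \<bullet> (\<xi> x + \<xi> (- x)) = 0" for h
    by (simp add: inner_add_right)
  from this[of "\<xi> x + \<xi> (- x)"] have "\<xi> x + \<xi> (- x) = 0" by simp
  then show ?thesis by (simp add: eq_neg_iff_add_eq_0 add.commute)
qed

text \<open>The volume of the ball minus its covariogram at \<open>z\<close>, that is, the loss of
  volume in the overlap of the ball with its translate by \<open>- z\<close>.\<close>

definition overshoot :: "'a \<Rightarrow> real" where
  "overshoot z = measure lborel {x. N x \<le> 1 \<and> 1 < N (x + z)}"

lemma fmeasurable_overshoot: "{x. N x \<le> r \<and> r < N (x + z)} \<in> fmeasurable lborel"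
  by (rule fmeasurableI2[OF fmeasurable_ball[of r]]) auto

lemma overshoot_nonneg [simp]: "0 \<le> overshoot z"
  by (simp add: overshoot_def)

lemma emeasure_overshoot: "emeasure lborel {x. N x \<le> 1 \<and> 1 < N (x + z)} = ennreal (overshoot z)"
  unfolding overshoot_def using fmeasurable_overshoot[of 1 z] by (simp add: emeasure_eq_measure2)

lemma measurable_overshoot [measurable]: "overshoot \<in> borel_measurable borel"
proof -
  have [measurable]: "Measurable.pred (borel \<Otimes>\<^sub>M lborel) (\<lambda>p. N (snd p) \<le> 1 \<and> 1 < N (snd p + fst p))"
    by measurable
  have "(\<lambda>z. LINT x|lborel. indicat_real {p. N (snd p) \<le> 1 \<and> 1 < N (snd p + fst p)} (z, x)) \<in> borel_measurable borel"
    by measurable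
  moreover have "(LINT x|lborel. indicat_real {p. N (snd p) \<le> 1 \<and> 1 < N (snd p + fst p)} (z, x)) = overshoot z" for z
  proof -
    have "(LINT x|lborel. indicat_real {p. N (snd p) \<le> 1 \<and> 1 < N (snd p + fst p)} (z, x))
      = (LINT x|lborel. indicat_real {x. N x \<le> 1 \<and> 1 < N (x + z)} x)"
      by (intro Bochner_Integration.integral_cong) (auto simp: indicator_def)
    then show ?thesis by (simp add: overshoot_def)
  qed
  ultimately show ?thesis by simp
qed

lemma overshoot_le_volume: "overshoot z \<le> unit_ball_volume"
  unfolding overshoot_def by (rule measure_mono_fmeasurable) (auto simp: fmeasurable_ball)

text \<open>A point that has left the ball after the translation by \<open>y + z\<close> either left
  under \<open>y\<close>, or was still inside after \<open>y\<close> and left under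
  \<open>z\<close>. The second set is a translate of the one measured by
  \<open>overshoot z\<close>.\<close>

lemma overshoot_add: "overshoot (y + z) \<le> overshoot y + overshoot z"
proof -
  let ?A = "{x. N x \<le> 1 \<and> 1 < N (x + y)}" and ?B = "{x. N x \<le> 1 \<and> 1 < N (x + z)}"
  let ?B' = "{x. N (y + x) \<le> 1 \<and> 1 < N (y + x + z)}"
  have "emeasure lborel ?B = emeasure (distr lborel borel ((+) y)) ?B"
    by (simp add: lborel_distr_plus)
  also have "\<dots> = emeasure lborel ?B'"
    by (subst emeasure_distr) (auto simp: vimage_def)
  finally have B': "emeasure lborel ?B' = ennreal (overshoot z)"
    by (simp add: emeasure_overshoot)
  have "ennreal (overshoot (y + z)) = emeasure lborel {x. N x \<le> 1 \<and> 1 < N (x + (y + z))}"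
    by (simp add: emeasure_overshoot)
  also have "\<dots> \<le> emeasure lborel (?A \<union> ?B')"
    by (intro emeasure_mono) (auto simp: add_ac)
  also have "\<dots> \<le> emeasure lborel ?A + emeasure lborel ?B'"
    by (intro emeasure_subadditive) auto
  also have "\<dots> = ennreal (overshoot y + overshoot z)"
    by (simp add: emeasure_overshoot B')
  finally show ?thesis by (subst (asm) ennreal_le_iff) auto
qed

text \<open>Only points with \<open>1 - N z < N x \<le> 1\<close> can leave the ball, and
  Bernoulli's inequality bounds the volume of this shell linearly. For \<open>1 \<le> N z\<close>
  the full volume of the ball is a sufficient bound.\<close>

lemma overshoot_le: "overshoot z \<le> DIM('a) * unit_ball_volume * N z"
proof (cases "N z < 1")
  case True
  have "overshoot z \<le> unit_ball_volume - (1 - N z) ^ DIM('a) * unit_ball_volume"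
  proof -
    have "overshoot z \<le> measure lborel ({x. N x \<le> 1} - {x. N x \<le> 1 - N z})"
      unfolding overshoot_def
    proof (rule measure_mono_fmeasurable)
      show "{x. N x \<le> 1 \<and> 1 < N (x + z)} \<subseteq> {x. N x \<le> 1} - {x. N x \<le> 1 - N z}"
      proof safe
        fix x assume "1 < N (x + z)" "N x \<le> 1 - N z"
        then show False using triangle[of x z] by simp
      qed
    qed (auto intro!: fmeasurable.Diff fmeasurable_ball fmeasurableD fmeasurable_overshoot)
    also have "\<dots> = unit_ball_volume - measure lborel {x. N x \<le> 1 - N z}"
      using fmeasurable_ball emeasure_compact_finite[OF compact_ball] nonneg[of z]
      by (intro measure_Diff) (auto simp: less_top intro: order_trans)
    also have "\<dots> = unit_ball_volume - (1 - N z) ^ DIM('a) * unit_ball_volume"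
      using measure_ball[of "1 - N z"] True by simp
    finally show ?thesis .
  qed
  also have "\<dots> = (1 - (1 - N z) ^ DIM('a)) * unit_ball_volume"
    by (simp add: algebra_simps)
  also have "\<dots> \<le> (DIM('a) * N z) * unit_ball_volume"
    using Bernoulli_inequality[of "- N z" "DIM('a)"] True by (intro mult_right_mono) auto
  finally show ?thesis by (simp add: mult_ac)
next
  case False
  have "1 * unit_ball_volume * 1 \<le> DIM('a) * unit_ball_volume * N z"
    using False DIM_positive[where 'a='a] by (intro mult_mono) (auto simp: Suc_le_eq)
  with overshoot_le_volume[of z] show ?thesis by simp
qed

lemma emeasure_overshoot_scaled:
  assumes "0 < r"
  shows "emeasure lborel {x. N x \<le> r \<and> r < N (x + z)} = ennreal (r ^ DIM('a) * overshoot (z /\<^sub>R r))"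
proof -
  have "emeasure lborel {x. N x \<le> r \<and> r < N (x + z)} = (\<integral>\<^sup>+x. indicator {x. N x \<le> r \<and> r < N (x + z)} x \<partial>lborel)"
    by (subst nn_integral_indicator) measurable
  also have "\<dots> = ennreal (\<bar>r\<bar> ^ DIM('a)) * (\<integral>\<^sup>+x. indicator {x. N x \<le> r \<and> r < N (x + z)} (0 + r *\<^sub>R x) \<partial>lborel)"
    using assms by (intro nn_integral_lborel_affine) auto
  also have "(\<integral>\<^sup>+x. indicator {x. N x \<le> r \<and> r < N (x + z)} (0 + r *\<^sub>R x) \<partial>lborel) =
      (\<integral>\<^sup>+x. indicator {x. N x \<le> 1 \<and> 1 < N (x + z /\<^sub>R r)} x \<partial>lborel)"
  proof (intro nn_integral_cong)
    fix x
    have "N (r *\<^sub>R x) = r * N x" using assms by (simp add: scale)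
    moreover have "N (r *\<^sub>R x + z) = r * N (x + z /\<^sub>R r)"
      using scale[of r "x + z /\<^sub>R r"] assms by (simp add: scaleR_add_right)
    ultimately show "indicator {x. N x \<le> r \<and> r < N (x + z)} (0 + r *\<^sub>R x) =
      (indicator {x. N x \<le> 1 \<and> 1 < N (x + z /\<^sub>R r)} x :: ennreal)"
      using assms by (auto simp: indicator_def)
  qed
  also have "\<dots> = ennreal (overshoot (z /\<^sub>R r))"
    by (subst nn_integral_indicator) (auto simp: emeasure_overshoot)
  finally show ?thesis using assms by (simp add: ennreal_mult)
qed

text \<open>Layer cake over the superlevel sets of \<open>tent 1\<close>, which are the balls of radius \<open>r \<le> 1\<close>.\<close>
lemma nn_integral_tent_decrease:
  "(\<integral>\<^sup>+x. ennreal (tent 1 x - tent 1 (x + z)) \<partial>lborel)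
    = (\<integral>\<^sup>+r\<in>{0<..1}. ennreal (r ^ DIM('a) * overshoot (z /\<^sub>R r)) \<partial>lborel)"
proof -
  have layer: "ennreal (tent 1 x - tent 1 (x + z)) =
      (\<integral>\<^sup>+r. indicator {0<..1} r * indicator {r. N x \<le> r \<and> r < N (x + z)} r \<partial>lborel)" for x
  proof -
    have "(\<integral>\<^sup>+r. indicator {0<..1} r * indicator {r. N x \<le> r \<and> r < N (x + z)} r \<partial>lborel) =
       (\<integral>\<^sup>+r. indicator {N x..<min 1 (N (x + z))} r \<partial>lborel)"
    proof (rule nn_integral_cong_AE)
      show "AE r in lborel. indicator {0<..1} r * indicator {r. N x \<le> r \<and> r < N (x + z)} r =
          (indicator {N x..<min 1 (N (x + z))} r :: ennreal)"
        using AE_lborel_singleton[of "0::real"] AE_lborel_singleton[of "1::real"]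
      proof eventually_elim
        case (elim r)
        have "0 \<le> r" if "N x \<le> r" using order_trans[OF nonneg that] .
        with elim show ?case by (auto simp: indicator_def)
      qed
    qed
    also have "\<dots> = ennreal (tent 1 x - tent 1 (x + z))"
      by (cases "N x \<le> min 1 (N (x + z))") (auto simp: tent_def max_def min_def ennreal_neg)
    finally show ?thesis ..
  qed
  have meas: "(\<lambda>p. indicator {0<..1} (fst p) * indicator {p. N (snd p) \<le> fst p \<and> fst p < N (snd p + z)} p :: ennreal)
      \<in> borel_measurable (lborel \<Otimes>\<^sub>M lborel)" for z
    by measurable
  have "(\<integral>\<^sup>+x. ennreal (tent 1 x - tent 1 (x + z)) \<partial>lborel) =
    (\<integral>\<^sup>+x. (\<integral>\<^sup>+r. indicator {0<..1} r * indicator {r. N x \<le> r \<and> r < N (x + z)} r \<partial>lborel) \<partial>lborel)"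
    unfolding layer ..
  also have "\<dots> = (\<integral>\<^sup>+r. (\<integral>\<^sup>+x. indicator {0<..1} r * indicator {r. N x \<le> r \<and> r < N (x + z)} r \<partial>lborel) \<partial>lborel)"
    using meas[of z] by (intro lborel_pair.Fubini') (simp add: case_prod_beta indicator_def cong: if_cong)
  also have "\<dots> = (\<integral>\<^sup>+r\<in>{0<..1}. ennreal (r ^ DIM('a) * overshoot (z /\<^sub>R r)) \<partial>lborel)"
  proof (rule nn_integral_cong)
    fix r :: real
    have "(\<integral>\<^sup>+x. indicator {0<..1} r * indicator {r. N x \<le> r \<and> r < N (x + z)} r \<partial>lborel) =
       (\<integral>\<^sup>+x. indicator {0<..1} r * indicator {x. N x \<le> r \<and> r < N (x + z)} x \<partial>lborel)"
      by (intro nn_integral_cong) (auto simp: indicator_def)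
    also have "\<dots> = indicator {0<..1} r * emeasure lborel {x. N x \<le> r \<and> r < N (x + z)}"
      by (subst nn_integral_cmult) auto
    also have "\<dots> = ennreal (r ^ DIM('a) * overshoot (z /\<^sub>R r)) * indicator {0<..1} r"
      using emeasure_overshoot_scaled[of r z] by (auto simp: indicator_def)
    finally show "(\<integral>\<^sup>+x. indicator {0<..1} r * indicator {r. N x \<le> r \<and> r < N (x + z)} r \<partial>lborel) = \<dots>" .
  qed
  finally show ?thesis .
qed

end

text \<open>All that the heat content argument uses of the stable law: a finite mean norm, and a
  mean of \<open>\<bar>y \<bullet> \<xi> x\<bar>\<close> that is the same for every nonzero
  \<open>x\<close>.\<close>

locale smooth_norm_prob = smooth_norm N \<xi> + prob_space \<mu>
  for N :: "'a::euclidean_space \<Rightarrow> real" and \<xi> and \<mu> :: "'a measure" +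
  fixes c :: real
  assumes sets_\<mu> [measurable_cong]: "sets \<mu> = sets borel"
    and integrable_norm: "integrable \<mu> N"
    and c_nonneg: "0 \<le> c"
    and mean_gradient: "x \<noteq> 0 \<Longrightarrow> (\<integral>\<^sup>+y. ennreal \<bar>y \<bullet> \<xi> x\<bar> \<partial>\<mu>) = ennreal c"
begin

text \<open>The heat content at scale \<open>s = t powr (1 / \<alpha>)\<close>, as
  \<open>heat_content_unit_ball\<close> shows.\<close>

definition mean_overshoot :: "real \<Rightarrow> real" where
  "mean_overshoot s = (LINT y|\<mu>. overshoot (s *\<^sub>R y))"

lemma integrable_overshoot: "integrable \<mu> (\<lambda>y. overshoot (s *\<^sub>R y))"
  by (rule integrable_const_bound[where B=unit_ball_volume]) (auto simp: overshoot_le_volume)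

lemma nn_integral_overshoot: "(\<integral>\<^sup>+y. ennreal (overshoot (s *\<^sub>R y)) \<partial>\<mu>) = ennreal (mean_overshoot s)"
  unfolding mean_overshoot_def by (rule nn_integral_eq_integral[OF integrable_overshoot]) simp

lemma measurable_mean_overshoot [measurable]: "mean_overshoot \<in> borel_measurable borel"
  unfolding mean_overshoot_def[abs_def] by measurable

lemma mean_overshoot_nonneg [simp]: "0 \<le> mean_overshoot s"
  unfolding mean_overshoot_def by simp

lemma mean_overshoot_add: "mean_overshoot (s + t) \<le> mean_overshoot s + mean_overshoot t"
proof -
  have "mean_overshoot (s + t) \<le> (LINT y|\<mu>. overshoot (s *\<^sub>R y) + overshoot (t *\<^sub>R y))"
    unfolding mean_overshoot_def
    by (intro integral_mono Bochner_Integration.integrable_add integrable_overshoot)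
      (simp add: scaleR_add_left overshoot_add)
  then show ?thesis
    unfolding mean_overshoot_def using integrable_overshoot by simp
qed

lemma mean_overshoot_le:
  assumes "0 \<le> s"
  shows "mean_overshoot s \<le> (DIM('a) * unit_ball_volume * (LINT y|\<mu>. N y)) * s"
proof -
  have "mean_overshoot s \<le> (LINT y|\<mu>. DIM('a) * unit_ball_volume * s * N y)"
    unfolding mean_overshoot_def
    using integrable_norm assms overshoot_le[of "s *\<^sub>R _"]
    by (intro integral_mono integrable_overshoot) (auto simp: scale mult_ac)
  then show ?thesis by (simp add: mult_ac)
qed

text \<open>The layer cake formula averaged over \<open>\<mu>\<close> and divided by
  \<open>s\<close>. As \<open>s\<close> tends to 0 the left side involves only the limit of
  \<open>mean_overshoot s / s\<close>, the right side the gradient of the tent.\<close>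

lemma nn_integral_mean_overshoot:
  assumes "0 < s"
  shows "(\<integral>\<^sup>+r\<in>{0<..1}. ennreal (r ^ DIM('a) * (mean_overshoot (s / r) / s)) \<partial>lborel)
    = (\<integral>\<^sup>+y. (\<integral>\<^sup>+x. ennreal ((tent 1 x - tent 1 (x + s *\<^sub>R y)) / s) \<partial>lborel) \<partial>\<mu>)"
proof -
  interpret P: pair_sigma_finite "lborel :: real measure" \<mu> ..
  \<comment> \<open>This holds for negative \<open>a\<close> too, where both sides are truncated to
    0.\<close>
  have pull: "ennreal (a / s) = ennreal (inverse s) * ennreal a" for a
    using assms by (cases "0 \<le> a") (auto simp: ennreal_mult[symmetric] ennreal_neg divide_nonpos_pos field_simps)
  have "(\<integral>\<^sup>+y. (\<integral>\<^sup>+x. ennreal ((tent 1 x - tent 1 (x + s *\<^sub>R y)) / s) \<partial>lborel) \<partial>\<mu>)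
    = ennreal (inverse s) * (\<integral>\<^sup>+y. (\<integral>\<^sup>+x. ennreal (tent 1 x - tent 1 (x + s *\<^sub>R y)) \<partial>lborel) \<partial>\<mu>)"
    unfolding pull by (subst nn_integral_cmult[symmetric]) (auto simp: nn_integral_cmult)
  also have "(\<integral>\<^sup>+y. (\<integral>\<^sup>+x. ennreal (tent 1 x - tent 1 (x + s *\<^sub>R y)) \<partial>lborel) \<partial>\<mu>)
    = (\<integral>\<^sup>+y. (\<integral>\<^sup>+r. ennreal (r ^ DIM('a) * overshoot ((s *\<^sub>R y) /\<^sub>R r)) * indicator {0<..1} r \<partial>lborel) \<partial>\<mu>)"
    by (simp add: nn_integral_tent_decrease)
  also have "\<dots> = (\<integral>\<^sup>+r. (\<integral>\<^sup>+y. ennreal (r ^ DIM('a) * overshoot ((s *\<^sub>R y) /\<^sub>R r)) * indicator {0<..1} r \<partial>\<mu>) \<partial>lborel)"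
    by (rule P.Fubini') measurable
  also have "\<dots> = (\<integral>\<^sup>+r. ennreal (r ^ DIM('a) * mean_overshoot (s / r)) * indicator {0<..1} r \<partial>lborel)"
  proof (rule nn_integral_cong)
    fix r :: real
    show "(\<integral>\<^sup>+y. ennreal (r ^ DIM('a) * overshoot ((s *\<^sub>R y) /\<^sub>R r)) * indicator {0<..1} r \<partial>\<mu>)
      = ennreal (r ^ DIM('a) * mean_overshoot (s / r)) * indicator {0<..1} r"
    proof (cases "r \<in> {0<..1}")
      case True
      have "(\<integral>\<^sup>+y. ennreal (r ^ DIM('a) * overshoot ((s *\<^sub>R y) /\<^sub>R r)) * indicator {0<..1} r \<partial>\<mu>)
        = (\<integral>\<^sup>+y. ennreal (r ^ DIM('a)) * ennreal (overshoot ((s / r) *\<^sub>R y)) \<partial>\<mu>)"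
        using True by (intro nn_integral_cong) (simp add: ennreal_mult divide_inverse mult.commute)
      also have "\<dots> = ennreal (r ^ DIM('a)) * ennreal (mean_overshoot (s / r))"
        by (subst nn_integral_cmult) (auto simp: nn_integral_overshoot)
      finally show ?thesis using True by (simp add: ennreal_mult)
    qed simp
  qed
  also have "ennreal (inverse s) * \<dots> = (\<integral>\<^sup>+r. ennreal (inverse s) * (ennreal (r ^ DIM('a) * mean_overshoot (s / r)) * indicator {0<..1} r) \<partial>lborel)"
    by (rule nn_integral_cmult[symmetric]) measurable
  also have "\<dots> = (\<integral>\<^sup>+r\<in>{0<..1}. ennreal (r ^ DIM('a) * (mean_overshoot (s / r) / s)) \<partial>lborel)"
    by (intro nn_integral_cong) (simp add: mult.assoc[symmetric] pull[symmetric])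
  finally show ?thesis ..
qed

text \<open>The factor \<open>1 / 2\<close> comes from the reflection \<open>x \<mapsto> - x\<close> of the ball, under which \<open>\<xi>\<close> is odd.\<close>
lemma nn_integral_inner_gradient:
  "(\<integral>\<^sup>+y. (\<integral>\<^sup>+x. ennreal (indicator {x. N x < 1} x * (y \<bullet> \<xi> x)) \<partial>lborel) \<partial>\<mu>)
    = ennreal (c / 2 * unit_ball_volume)"
proof -
  interpret P: pair_sigma_finite "lborel :: 'a measure" \<mu> ..
  let ?I = "indicat_real {x. N x < 1}"
  let ?F = "\<lambda>y. \<integral>\<^sup>+x. ennreal (?I x * (y \<bullet> \<xi> x)) \<partial>lborel"
  have double: "2 * ?F y = (\<integral>\<^sup>+x. ennreal (?I x * \<bar>y \<bullet> \<xi> x\<bar>) \<partial>lborel)" for y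
  proof -
    have "?F y = ennreal (\<bar>- 1\<bar> ^ DIM('a)) * (\<integral>\<^sup>+x. ennreal (?I (0 + (- 1) *\<^sub>R x) * (y \<bullet> \<xi> (0 + (- 1) *\<^sub>R x))) \<partial>lborel)"
      by (rule nn_integral_lborel_affine) auto
    also have "\<dots> = (\<integral>\<^sup>+x. ennreal (?I x * (- (y \<bullet> \<xi> x))) \<partial>lborel)"
    proof -
      have "AE x in lborel. ennreal (?I (- x) * (y \<bullet> \<xi> (- x))) = ennreal (?I x * (- (y \<bullet> \<xi> x)))"
        using AE_lborel_singleton[of "0::'a"]
        by eventually_elim (auto simp: gradient_minus indicator_def)
      from nn_integral_cong_AE[OF this] show ?thesis by simp
    qed
    finally have "2 * ?F y = ?F y + (\<integral>\<^sup>+x. ennreal (?I x * (- (y \<bullet> \<xi> x))) \<partial>lborel)"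
      by (simp add: mult_2)
    also have "\<dots> = (\<integral>\<^sup>+x. ennreal (?I x * (y \<bullet> \<xi> x)) + ennreal (?I x * (- (y \<bullet> \<xi> x))) \<partial>lborel)"
      by (rule nn_integral_add[symmetric]) measurable
    also have "\<dots> = (\<integral>\<^sup>+x. ennreal (?I x * \<bar>y \<bullet> \<xi> x\<bar>) \<partial>lborel)"
      by (intro nn_integral_cong) (auto simp: indicator_def abs_if ennreal_neg)
    finally show ?thesis .
  qed
  have "2 * (\<integral>\<^sup>+y. ?F y \<partial>\<mu>) = (\<integral>\<^sup>+y. 2 * ?F y \<partial>\<mu>)"
    by (rule nn_integral_cmult[symmetric]) measurable
  also have "\<dots> = (\<integral>\<^sup>+y. (\<integral>\<^sup>+x. ennreal (?I x * \<bar>y \<bullet> \<xi> x\<bar>) \<partial>lborel) \<partial>\<mu>)"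
    unfolding double ..
  also have "\<dots> = (\<integral>\<^sup>+x. (\<integral>\<^sup>+y. ennreal (?I x * \<bar>y \<bullet> \<xi> x\<bar>) \<partial>\<mu>) \<partial>lborel)"
    by (rule P.Fubini') measurable
  also have "\<dots> = (\<integral>\<^sup>+x. ennreal c * indicator {x. N x \<le> 1} x \<partial>lborel)"
  proof (rule nn_integral_cong_AE)
    show "AE x in lborel. (\<integral>\<^sup>+y. ennreal (?I x * \<bar>y \<bullet> \<xi> x\<bar>) \<partial>\<mu>) = ennreal c * indicator {x. N x \<le> 1} x"
      using AE_lborel_singleton[of "0::'a"] AE_sphere[OF zero_less_one]
      by eventually_elim (auto simp: mean_gradient indicator_def)
  qed
  also have "\<dots> = ennreal c * ennreal unit_ball_volume"
    using emeasure_ball[of 1] by (subst nn_integral_cmult_indicator) auto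
  finally have *: "2 * (\<integral>\<^sup>+y. ?F y \<partial>\<mu>) = ennreal (c * unit_ball_volume)"
    by (simp add: ennreal_mult c_nonneg)
  then have "2 * (\<integral>\<^sup>+y. ?F y \<partial>\<mu>) = 2 * ennreal (c / 2 * unit_ball_volume)"
    using ennreal_mult[of 2 "c / 2 * unit_ball_volume"] c_nonneg by simp
  then show ?thesis
    by (subst (asm) ennreal_mult_cancel_left) auto
qed

text \<open>Subadditivity yields only the existence of the limit \<open>L\<close>. Its value follows
  by dominated convergence on both sides of \<open>nn_integral_mean_overshoot\<close>: the left
  tends to \<open>L / DIM('a)\<close>, the integral of \<open>r ^ (DIM('a) - 1) * L\<close>, the
  right to \<open>c / 2 * unit_ball_volume\<close>.\<close>

lemma mean_overshoot_tendsto: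
  "((\<lambda>s. mean_overshoot s / s) \<longlongrightarrow> c / 2 * (DIM('a) * unit_ball_volume)) (at_right 0)"
proof -
  define C where "C = DIM('a) * unit_ball_volume * (LINT y|\<mu>. N y)"
  have quot: "mean_overshoot s / s \<le> C" if "0 < s" for s
    using mean_overshoot_le[of s] that by (simp add: divide_le_eq C_def)
  obtain L where L: "((\<lambda>s. mean_overshoot s / s) \<longlongrightarrow> L) (at_right 0)"
    using subadditive_quotient_tendsto[of mean_overshoot C,
        OF mean_overshoot_add mean_overshoot_le[folded C_def] mean_overshoot_nonneg] by blast
  have L_nonneg: "0 \<le> L"
    by (rule tendsto_lowerbound[OF L]) (auto simp: eventually_at_right_less intro!: eventually_at_rightI[of 0 1])
  define e where "e n = inverse (real (Suc n))" for n
  have e: "0 < e n" for n by (simp add: e_def)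
  have e_lim: "e \<longlonglongrightarrow> 0" unfolding e_def by (rule LIMSEQ_inverse_real_of_nat)
  have lhs: "(\<lambda>n. \<integral>\<^sup>+r\<in>{0<..1}. ennreal (r ^ DIM('a) * (mean_overshoot (e n / r) / e n)) \<partial>lborel)
    \<longlonglongrightarrow> (\<integral>\<^sup>+r\<in>{0<..1}. ennreal (r ^ (DIM('a) - 1) * L) \<partial>lborel)"
  proof (rule nn_integral_dominated_convergence[where w="\<lambda>r. ennreal C * indicator {0<..1} r"])
    show "AE r in lborel. ennreal (r ^ DIM('a) * (mean_overshoot (e n / r) / e n)) * indicator {0<..1} r \<le> ennreal C * indicator {0<..1} r" for n
    proof (rule AE_I2)
      fix r :: real
      show "ennreal (r ^ DIM('a) * (mean_overshoot (e n / r) / e n)) * indicator {0<..1} r \<le> ennreal C * indicator {0<..1} r"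
      proof (cases "r \<in> {0<..1}")
        case True
        \<comment> \<open>One factor \<open>r\<close> is spent to form the quotient at the scale
          \<open>e n / r\<close>, where the bound \<open>C\<close> is available.\<close>
        have "r ^ DIM('a) * (mean_overshoot (e n / r) / e n) = r ^ (DIM('a) - 1) * (mean_overshoot (e n / r) / (e n / r))"
          using True by (simp add: power_eq_if)
        also have "\<dots> \<le> 1 * C"
          using True quot[of "e n / r"] e[of n] by (intro mult_mono power_le_one) auto
        finally show ?thesis using True by (simp add: ennreal_leI)
      qed simp
    qed
    show "AE r in lborel. (\<lambda>n. ennreal (r ^ DIM('a) * (mean_overshoot (e n / r) / e n)) * indicator {0<..1} r)
        \<longlonglongrightarrow> ennreal (r ^ (DIM('a) - 1) * L) * indicator {0<..1} r"
    proof (rule AE_I2)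
      fix r :: real
      show "(\<lambda>n. ennreal (r ^ DIM('a) * (mean_overshoot (e n / r) / e n)) * indicator {0<..1} r)
        \<longlonglongrightarrow> ennreal (r ^ (DIM('a) - 1) * L) * indicator {0<..1} r"
      proof (cases "r \<in> {0<..1}")
        case True
        have eq: "r ^ DIM('a) * (mean_overshoot (e n / r) / e n) = r ^ (DIM('a) - 1) * (mean_overshoot (e n / r) / (e n / r))" for n
          using True by (simp add: power_eq_if)
        have "(\<lambda>n. e n / r) \<longlonglongrightarrow> 0 / r" by (intro tendsto_divide e_lim tendsto_const) (use True in auto)
        then have "filterlim (\<lambda>n. e n / r) (at_right 0) sequentially"
          using True e by (intro tendsto_imp_filterlim_at_right) auto
        then have "(\<lambda>n. mean_overshoot (e n / r) / (e n / r)) \<longlonglongrightarrow> L"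
          by (rule filterlim_compose[OF L])
        then have "(\<lambda>n. ennreal (r ^ (DIM('a) - 1) * (mean_overshoot (e n / r) / (e n / r)))) \<longlonglongrightarrow> ennreal (r ^ (DIM('a) - 1) * L)"
          by (intro tendsto_ennrealI tendsto_mult tendsto_const)
        then show ?thesis unfolding eq using True by simp
      qed simp
    qed
    show "(\<integral>\<^sup>+r. ennreal C * indicator {0<..1::real} r \<partial>lborel) < \<infinity>"
      by (subst nn_integral_cmult_indicator) (auto simp: ennreal_mult_less_top)
  qed (use measurable_mean_overshoot in measurable)
  have lhs_value: "(\<integral>\<^sup>+r\<in>{0<..1}. ennreal (r ^ (DIM('a) - 1) * L) \<partial>lborel) = ennreal (L / DIM('a))"
  proof -
    have "(\<integral>\<^sup>+r. ennreal (r ^ (DIM('a) - 1) * L) * indicator {0..1} r \<partial>lborel) = ennreal (1 ^ DIM('a) * L / DIM('a) - 0 ^ DIM('a) * L / DIM('a))"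
      using L_nonneg by (intro nn_integral_FTC_Icc) (auto intro!: derivative_eq_intros mult_nonneg_nonneg)
    moreover have "(\<integral>\<^sup>+r\<in>{0<..1}. ennreal (r ^ (DIM('a) - 1) * L) \<partial>lborel) = (\<integral>\<^sup>+r\<in>{0..1}. ennreal (r ^ (DIM('a) - 1) * L) \<partial>lborel)"
      using AE_lborel_singleton[of "0::real"] by (intro nn_integral_cong_AE) (auto simp: indicator_def)
    ultimately show ?thesis by (simp add: power_0_left)
  qed
  have rhs: "(\<lambda>n. \<integral>\<^sup>+y. (\<integral>\<^sup>+x. ennreal ((tent 1 x - tent 1 (x + e n *\<^sub>R y)) / e n) \<partial>lborel) \<partial>\<mu>)
     \<longlonglongrightarrow> (\<integral>\<^sup>+y. (\<integral>\<^sup>+x. ennreal (indicator {x. N x < 1} x * (y \<bullet> \<xi> x)) \<partial>lborel) \<partial>\<mu>)"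
  proof -
    \<comment> \<open>Inside the ball the tent is Lipschitz with respect to \<open>N\<close>;
      outside, \<open>tent 1 x\<close> is 0, so the difference is not positive and
      \<open>ennreal\<close> truncates it.\<close>
    have bound: "ennreal ((tent 1 x - tent 1 (x + e n *\<^sub>R y)) / e n) \<le> ennreal (N y) * indicator {x. N x \<le> 1} x" for n x y
    proof (cases "N x \<le> 1")
      case True
      have "tent 1 x - tent 1 (x + e n *\<^sub>R y) \<le> e n * N y"
        using tent_diff_le[of 1 x "e n *\<^sub>R y"] e[of n] by (simp add: scale)
      then show ?thesis using True e[of n] by (simp add: divide_le_eq mult.commute ennreal_leI)
    next
      case False
      then have "(tent 1 x - tent 1 (x + e n *\<^sub>R y)) / e n \<le> 0"
        using e[of n] by (simp add: tent_def divide_le_0_iff)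
      then show ?thesis using False by (simp add: ennreal_neg)
    qed
    have w: "(\<integral>\<^sup>+x. ennreal (N y) * indicator {x. N x \<le> 1} x \<partial>lborel) = ennreal (N y) * ennreal unit_ball_volume" for y
      using emeasure_ball[of 1] by (subst nn_integral_cmult_indicator) auto
    show ?thesis
    proof (rule nn_integral_dominated_convergence[where w="\<lambda>y. ennreal (N y) * ennreal unit_ball_volume"])
      show "AE y in \<mu>. (\<integral>\<^sup>+x. ennreal ((tent 1 x - tent 1 (x + e n *\<^sub>R y)) / e n) \<partial>lborel) \<le> ennreal (N y) * ennreal unit_ball_volume" for n
        unfolding w[symmetric] by (intro AE_I2 nn_integral_mono bound)
      show "(\<integral>\<^sup>+y. ennreal (N y) * ennreal unit_ball_volume \<partial>\<mu>) < \<infinity>"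
        using integrable_norm by (simp add: nn_integral_multc nn_integral_eq_integral ennreal_mult_less_top)
      show "AE y in \<mu>. (\<lambda>n. \<integral>\<^sup>+x. ennreal ((tent 1 x - tent 1 (x + e n *\<^sub>R y)) / e n) \<partial>lborel)
         \<longlonglongrightarrow> (\<integral>\<^sup>+x. ennreal (indicator {x. N x < 1} x * (y \<bullet> \<xi> x)) \<partial>lborel)"
      proof (rule AE_I2)
        fix y
        show "(\<lambda>n. \<integral>\<^sup>+x. ennreal ((tent 1 x - tent 1 (x + e n *\<^sub>R y)) / e n) \<partial>lborel)
         \<longlonglongrightarrow> (\<integral>\<^sup>+x. ennreal (indicator {x. N x < 1} x * (y \<bullet> \<xi> x)) \<partial>lborel)"
        proof (rule nn_integral_dominated_convergence[where w="\<lambda>x. ennreal (N y) * indicator {x. N x \<le> 1} x"])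
          show "(\<integral>\<^sup>+x. ennreal (N y) * indicator {x. N x \<le> 1} x \<partial>lborel) < \<infinity>"
            unfolding w by (simp add: ennreal_mult_less_top)
          show "AE x in lborel. (\<lambda>n. ennreal ((tent 1 x - tent 1 (x + e n *\<^sub>R y)) / e n))
              \<longlonglongrightarrow> ennreal (indicator {x. N x < 1} x * (y \<bullet> \<xi> x))"
            using AE_sphere[OF zero_less_one] AE_lborel_singleton[of "0::'a"]
          proof eventually_elim
            case (elim x)
            have "(\<lambda>n. - ((tent 1 (x + e n *\<^sub>R y) - tent 1 x) / e n)) \<longlonglongrightarrow> - (- (indicator {x. N x < 1} x * (y \<bullet> \<xi> x)))"
              unfolding e_def using elim by (intro tendsto_minus has_derivative_imp_LIMSEQ has_derivative_tent)
            then show ?case by (intro tendsto_ennrealI) (simp add: minus_divide_left)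
          qed
        qed (auto simp: bound)
      qed
    qed measurable
  qed
  have "ennreal (L / DIM('a)) = ennreal (c / 2 * unit_ball_volume)"
    using LIMSEQ_unique[OF lhs[unfolded nn_integral_mean_overshoot[OF e]] rhs]
    unfolding lhs_value nn_integral_inner_gradient .
  then have "L / DIM('a) = c / 2 * unit_ball_volume"
    using L_nonneg c_nonneg by (subst (asm) ennreal_inj) auto
  then have "L = c / 2 * (DIM('a) * unit_ball_volume)"
    by (simp add: field_simps)
  with L show ?thesis by simp
qed

text \<open>The reflection \<open>x \<mapsto> - z - x\<close> exchanges entering the ball under translation by \<open>z\<close> with leaving it.\<close>
lemma heat_content_unit_ball:
  "heat_content \<alpha> \<mu> t {x. N x \<le> 1} (- {x. N x \<le> 1}) = ennreal (mean_overshoot (t powr (1 / \<alpha>)))"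
proof -
  interpret P: pair_sigma_finite \<mu> "lborel :: 'a measure" ..
  define s where "s = t powr (1 / \<alpha>)"
  let ?W = "{x. N x \<le> 1}"
  have semigroup: "ennreal (stable_semigroup \<alpha> \<mu> t (indicat_real ?W) x) = (\<integral>\<^sup>+y. indicator ?W (x + s *\<^sub>R y) \<partial>\<mu>)" for x
  proof -
    have "integrable \<mu> (\<lambda>y. indicat_real ?W (x + s *\<^sub>R y))"
      by (rule integrable_const_bound[where B=1]) auto
    then show ?thesis
      unfolding stable_semigroup_def s_def[symmetric]
      by (subst nn_integral_eq_integral[symmetric]) (auto simp: ennreal_indicator)
  qed
  have reflect: "(\<integral>\<^sup>+x. indicator ?W (x + z) * indicator (- ?W) x \<partial>lborel) = ennreal (overshoot z)" for z
  proof -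
    have "(\<integral>\<^sup>+x. indicator ?W (x + z) * indicator (- ?W) x \<partial>lborel) =
        ennreal (\<bar>- 1\<bar> ^ DIM('a)) * (\<integral>\<^sup>+x. indicator ?W ((- z + (- 1) *\<^sub>R x) + z) * indicator (- ?W) (- z + (- 1) *\<^sub>R x) \<partial>lborel)"
      by (rule nn_integral_lborel_affine) auto
    also have "\<dots> = (\<integral>\<^sup>+x. indicator {x. N x \<le> 1 \<and> 1 < N (x + z)} x \<partial>lborel)"
    proof -
      have "N (- z - x) = N (x + z)" for x
      proof -
        have "- z - x = - (x + z)" by simp
        then show ?thesis by (simp only: minus)
      qed
      then show ?thesis by (auto intro!: nn_integral_cong simp: indicator_def)
    qed
    also have "\<dots> = ennreal (overshoot z)"
      by (subst nn_integral_indicator) (auto simp: emeasure_overshoot)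
    finally show ?thesis .
  qed
  have "heat_content \<alpha> \<mu> t ?W (- ?W) = (\<integral>\<^sup>+x. (\<integral>\<^sup>+y. indicator ?W (x + s *\<^sub>R y) * indicator (- ?W) x \<partial>\<mu>) \<partial>lborel)"
    unfolding heat_content_def semigroup by (intro nn_integral_cong nn_integral_multc[symmetric]) auto
  also have "\<dots> = (\<integral>\<^sup>+y. (\<integral>\<^sup>+x. indicator ?W (x + s *\<^sub>R y) * indicator (- ?W) x \<partial>lborel) \<partial>\<mu>)"
    by (rule P.Fubini') measurable
  also have "\<dots> = ennreal (mean_overshoot s)"
    unfolding reflect by (rule nn_integral_overshoot)
  finally show ?thesis unfolding s_def .
qed

end

section \<open>The stable norm\<close>

text \<open>Convexity of the power on positive reals is extended to the end point 0, where
  \<open>w powr \<alpha> \<le> w\<close> for \<open>w\<close> in the unit interval suffices, and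
  then to both signs by the triangle inequality.\<close>

lemma convex_on_abs_powr:
  assumes "1 \<le> (\<alpha>::real)"
  shows "convex_on UNIV (\<lambda>x::real. \<bar>x\<bar> powr \<alpha>)"
proof -
  have nonneg: "(u * a + v * b) powr \<alpha> \<le> u * a powr \<alpha> + v * b powr \<alpha>"
    if "0 \<le> a" "0 \<le> b" "0 \<le> u" "0 \<le> v" "u + v = 1" for a b u v
  proof -
    have shrink: "(w * x) powr \<alpha> \<le> w * x powr \<alpha>" if "0 \<le> w" "w \<le> 1" "0 \<le> x" for w x
    proof (cases "w = 0")
      case False
      have "w powr \<alpha> \<le> w powr 1" using that assms False by (intro powr_mono') auto
      then show ?thesis using that by (simp add: powr_mult mult_right_mono)
    qed simp
    show ?thesis
    proof (cases "a = 0 \<or> b = 0")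
      case True
      then show ?thesis using shrink[of v b] shrink[of u a] that by auto
    next
      case False
      then have "((1 - v) * a + v * b) powr \<alpha> \<le> (1 - v) * a powr \<alpha> + v * b powr \<alpha>"
        using convex_onD[OF powr_convex[OF assms], of v a b] that by simp
      moreover have u: "u = 1 - v" using that by simp
      ultimately show ?thesis unfolding u by simp
    qed
  qed
  show ?thesis
  proof (rule convex_onI)
    fix t x y :: real assume t: "0 < t" "t < 1"
    have "\<bar>(1 - t) *\<^sub>R x + t *\<^sub>R y\<bar> powr \<alpha> \<le> ((1 - t) * \<bar>x\<bar> + t * \<bar>y\<bar>) powr \<alpha>"
      using t assms abs_triangle_ineq[of "(1 - t) * x" "t * y"] by (intro powr_mono2) (auto simp: abs_mult)
    also have "\<dots> \<le> (1 - t) * \<bar>x\<bar> powr \<alpha> + t * \<bar>y\<bar> powr \<alpha>"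
      using t by (intro nonneg) auto
    finally show "\<bar>(1 - t) *\<^sub>R x + t *\<^sub>R y\<bar> powr \<alpha> \<le> (1 - t) * \<bar>x\<bar> powr \<alpha> + t * \<bar>y\<bar> powr \<alpha>" .
  qed simp
qed

text \<open>The mean value theorem on the two halves of the interval compares the increments,
  because the derivative is strictly increasing for \<open>1 < \<alpha>\<close>.\<close>

lemma powr_midpoint_less:
  fixes u v \<alpha> :: real
  assumes "1 < \<alpha>" "0 \<le> u" "u < v"
  shows "((u + v) / 2) powr \<alpha> < (u powr \<alpha> + v powr \<alpha>) / 2"
proof -
  let ?m = "(u + v) / 2"
  have deriv: "((\<lambda>x. x powr \<alpha>) has_real_derivative \<alpha> * x powr (\<alpha> - 1)) (at x)" if "0 < x" for x
    using that by (auto intro!: derivative_eq_intros)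
  have cont: "continuous_on {a..b} (\<lambda>x. x powr \<alpha>)" if "0 \<le> a" for a b
    using that assms by (intro continuous_on_powr' continuous_intros) auto
  have mv: "\<exists>y. a < y \<and> y < b \<and> b powr \<alpha> - a powr \<alpha> = \<alpha> * y powr (\<alpha> - 1) * (b - a)"
    if ab: "0 \<le> a" "a < b" for a b
  proof (rule mvt[OF ab(2) cont[OF ab(1)]])
    show "((\<lambda>x. x powr \<alpha>) has_derivative (*) (\<alpha> * x powr (\<alpha> - 1))) (at x)" if "a < x" "x < b" for x
      using deriv[of x] that ab by (simp add: has_field_derivative_def)
  qed blast
  obtain y where y: "u < y" "y < ?m" "?m powr \<alpha> - u powr \<alpha> = \<alpha> * y powr (\<alpha> - 1) * (?m - u)"
    using mv[of u ?m] assms by auto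
  obtain z where z: "?m < z" "z < v" "v powr \<alpha> - ?m powr \<alpha> = \<alpha> * z powr (\<alpha> - 1) * (v - ?m)"
    using mv[of ?m v] assms by auto
  have "y powr (\<alpha> - 1) < z powr (\<alpha> - 1)"
    using y z assms by (intro powr_less_mono2) auto
  then have "\<alpha> * y powr (\<alpha> - 1) * ((v - u) / 2) < \<alpha> * z powr (\<alpha> - 1) * ((v - u) / 2)"
    using assms by (intro mult_strict_right_mono mult_strict_left_mono) auto
  moreover have half: "?m - u = (v - u) / 2" "v - ?m = (v - u) / 2" by (simp_all add: field_simps)
  ultimately have "?m powr \<alpha> - u powr \<alpha> < v powr \<alpha> - ?m powr \<alpha>"
    unfolding y(3) z(3) by (simp only:)
  then show ?thesis by simp
qed

lemma abs_powr_midpoint_less: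
  fixes p q \<alpha> :: real
  assumes "1 < \<alpha>" "p \<noteq> q"
  shows "\<bar>(p + q) / 2\<bar> powr \<alpha> < (\<bar>p\<bar> powr \<alpha> + \<bar>q\<bar> powr \<alpha>) / 2"
proof (cases "\<bar>p\<bar> = \<bar>q\<bar>")
  case True
  \<comment> \<open>Distinct numbers of equal modulus are opposite, so their midpoint is 0 while the
    right-hand side is positive.\<close>
  then have "p + q = 0" "q \<noteq> 0" using assms by auto
  then show ?thesis using True assms by simp
next
  case False
  have "\<bar>(p + q) / 2\<bar> powr \<alpha> \<le> ((\<bar>p\<bar> + \<bar>q\<bar>) / 2) powr \<alpha>"
    using assms by (intro powr_mono2) auto
  also have "\<dots> < (\<bar>p\<bar> powr \<alpha> + \<bar>q\<bar> powr \<alpha>) / 2"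
    using powr_midpoint_less[of \<alpha> "\<bar>p\<bar>" "\<bar>q\<bar>"] powr_midpoint_less[of \<alpha> "\<bar>q\<bar>" "\<bar>p\<bar>"] False assms
    by (cases "\<bar>p\<bar> < \<bar>q\<bar>") (auto simp: add.commute)
  finally show ?thesis .
qed

locale nondegenerate_stable =
  fixes \<alpha> :: real and \<sigma> \<mu> :: "'a::euclidean_space measure"
  assumes \<alpha>: "1 < \<alpha>" and stable: "nondegenerate_symmetric_stable \<alpha> \<sigma> \<mu>"
begin

abbreviation M :: "'a \<Rightarrow> real" where "M \<equiv> stable_norm \<alpha> \<sigma>"

text \<open>The power \<open>M \<xi> powr \<alpha>\<close>: as an integral it inherits convexity
  pointwise, before the root is taken.\<close>

definition \<Lambda> :: "'a \<Rightarrow> real" where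
  "\<Lambda> \<xi> = (LINT y|spectral_measure \<alpha> \<sigma>. \<bar>y \<bullet> \<xi>\<bar> powr \<alpha>)"

lemma sets_\<sigma>: "sets \<sigma> = sets (restrict_space borel (sphere 0 1))"
  and finite_\<sigma>: "finite_measure \<sigma>"
  using stable by (auto simp: nondegenerate_symmetric_stable_def finite_symmetric_sphere_measure_def)

lemma space_spectral [simp]: "space (spectral_measure \<alpha> \<sigma>) = sphere 0 1"
  using sets_eq_imp_space_eq[OF sets_\<sigma>] by (simp add: spectral_measure_def space_scale_measure space_restrict_space)

lemma finite_measure_spectral: "finite_measure (spectral_measure \<alpha> \<sigma>)"
  using finite_measure.emeasure_finite[OF finite_\<sigma>, of "space \<sigma>"]
  by (intro finite_measureI) (simp add: spectral_measure_def space_scale_measure ennreal_mult_eq_top_iff)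

lemma measurable_spectral:
  assumes "f \<in> borel_measurable borel"
  shows "f \<in> borel_measurable (spectral_measure \<alpha> \<sigma>)"
proof -
  have "sets (spectral_measure \<alpha> \<sigma>) = sets (restrict_space borel (sphere 0 1))"
    by (simp add: spectral_measure_def sets_\<sigma>)
  from measurable_cong_sets[OF this refl] show ?thesis
    using measurable_restrict_space1[OF assms] by blast
qed

lemma integrable_spectral: "integrable (spectral_measure \<alpha> \<sigma>) (\<lambda>y. \<bar>y \<bullet> \<xi>\<bar> powr \<alpha>)"
proof (rule finite_measure.integrable_const_bound[OF finite_measure_spectral, where B="norm \<xi> powr \<alpha>"])
  show "AE y in spectral_measure \<alpha> \<sigma>. norm (\<bar>y \<bullet> \<xi>\<bar> powr \<alpha>) \<le> norm \<xi> powr \<alpha>"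
  proof (rule AE_I2)
    fix y assume "y \<in> space (spectral_measure \<alpha> \<sigma>)"
    then have "\<bar>y \<bullet> \<xi>\<bar> \<le> norm \<xi>" using Cauchy_Schwarz_ineq2[of y \<xi>] by simp
    then show "norm (\<bar>y \<bullet> \<xi>\<bar> powr \<alpha>) \<le> norm \<xi> powr \<alpha>"
      using \<alpha> by (simp add: powr_mono2)
  qed
qed (intro measurable_spectral, measurable)

lemma \<Lambda>_nonneg [simp]: "0 \<le> \<Lambda> \<xi>"
  unfolding \<Lambda>_def by (rule Bochner_Integration.integral_nonneg) simp

lemma norm_eq: "M \<xi> = \<Lambda> \<xi> powr (1 / \<alpha>)"
  by (simp add: stable_norm_def \<Lambda>_def)

lemma norm_powr: "M \<xi> powr \<alpha> = \<Lambda> \<xi>"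
  using \<alpha> by (simp add: norm_eq powr_powr)

lemma norm_le_1_iff: "M \<xi> \<le> 1 \<longleftrightarrow> \<Lambda> \<xi> \<le> 1"
proof
  assume "M \<xi> \<le> 1"
  then have "M \<xi> powr \<alpha> \<le> 1 powr \<alpha>"
    using \<alpha> by (intro powr_mono2) (auto simp: norm_eq)
  then show "\<Lambda> \<xi> \<le> 1" by (simp add: norm_powr)
next
  assume "\<Lambda> \<xi> \<le> 1"
  then have "\<Lambda> \<xi> powr (1 / \<alpha>) \<le> 1 powr (1 / \<alpha>)"
    using \<alpha> by (intro powr_mono2) auto
  then show "M \<xi> \<le> 1" by (simp add: norm_eq)
qed

lemma \<Lambda>_scale: "\<Lambda> (c *\<^sub>R \<xi>) = \<bar>c\<bar> powr \<alpha> * \<Lambda> \<xi>"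
  unfolding \<Lambda>_def by (simp add: abs_mult powr_mult)

lemma norm_scale: "M (c *\<^sub>R \<xi>) = \<bar>c\<bar> * M \<xi>"
  using \<alpha> by (simp add: norm_eq \<Lambda>_scale powr_mult powr_powr)

text \<open>Nondegeneracy bounds \<open>\<Lambda>\<close> below on the unit sphere, and homogeneity
  carries positivity to every nonzero vector.\<close>

lemma \<Lambda>_pos:
  assumes "\<xi> \<noteq> 0"
  shows "0 < \<Lambda> \<xi>"
proof -
  have inf: "0 < (INF y\<in>sphere 0 1. \<Lambda> y)"
    using stable
    by (simp add: nondegenerate_symmetric_stable_def nondegenerate_spectral_def \<Lambda>_def inner_commute)
  have "(INF y\<in>sphere 0 1. \<Lambda> y) \<le> \<Lambda> (\<xi> /\<^sub>R norm \<xi>)"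
    using assms by (intro cINF_lower bdd_belowI2[where m=0]) auto
  then have "0 < \<Lambda> (\<xi> /\<^sub>R norm \<xi>)" using inf by simp
  then show ?thesis by (simp add: \<Lambda>_scale zero_less_mult_iff)
qed

lemma norm_pos: "\<xi> \<noteq> 0 \<Longrightarrow> 0 < M \<xi>"
  using \<Lambda>_pos[of \<xi>] by (simp add: norm_eq)

lemma \<Lambda>_convex:
  assumes "0 \<le> u" "0 \<le> v" "u + v = 1"
  shows "\<Lambda> (u *\<^sub>R x + v *\<^sub>R y) \<le> u * \<Lambda> x + v * \<Lambda> y"
proof -
  have "\<Lambda> (u *\<^sub>R x + v *\<^sub>R y) \<le>
      (LINT z|spectral_measure \<alpha> \<sigma>. u * \<bar>z \<bullet> x\<bar> powr \<alpha> + v * \<bar>z \<bullet> y\<bar> powr \<alpha>)"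
    unfolding \<Lambda>_def
  proof (intro integral_mono integrable_spectral Bochner_Integration.integrable_add integrable_mult_right)
    fix z
    show "\<bar>z \<bullet> (u *\<^sub>R x + v *\<^sub>R y)\<bar> powr \<alpha> \<le> u * \<bar>z \<bullet> x\<bar> powr \<alpha> + v * \<bar>z \<bullet> y\<bar> powr \<alpha>"
    proof -
      have u: "u = 1 - v" using assms by simp
      show ?thesis
        using convex_onD[OF convex_on_abs_powr[of \<alpha>], of v "z \<bullet> x" "z \<bullet> y"] \<alpha> assms(2)
        using assms(1) unfolding u by (simp add: inner_add_right)
    qed
  qed
  then show ?thesis
    unfolding \<Lambda>_def using integrable_spectral by simp
qed

text \<open>Minkowski's inequality, from the convexity of \<open>\<Lambda>\<close> after normalising both vectors.\<close>
lemma norm_triangle: "M (x + y) \<le> M x + M y"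
proof (cases "x = 0 \<or> y = 0")
  case True
  have "M 0 = 0" using norm_scale[of 0 0] by simp
  with True show ?thesis by auto
next
  case False
  then have pos: "0 < M x" "0 < M y" by (auto intro: norm_pos)
  let ?s = "M x + M y"
  have "(x + y) /\<^sub>R ?s = (M x / ?s) *\<^sub>R (x /\<^sub>R M x) + (M y / ?s) *\<^sub>R (y /\<^sub>R M y)"
  proof -
    have "M x / ?s * inverse (M x) = inverse ?s" "M y / ?s * inverse (M y) = inverse ?s"
      using pos by (simp_all add: field_simps)
    then show ?thesis by (simp only: scaleR_scaleR scaleR_add_right)
  qed
  also have "\<Lambda> \<dots> \<le> M x / ?s * \<Lambda> (x /\<^sub>R M x) + M y / ?s * \<Lambda> (y /\<^sub>R M y)"
    using pos by (intro \<Lambda>_convex) (auto simp: add_divide_distrib[symmetric])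
  also have "\<Lambda> (x /\<^sub>R M x) = 1"
    using pos norm_powr[of "x /\<^sub>R M x"] by (simp add: norm_scale)
  also have "\<Lambda> (y /\<^sub>R M y) = 1"
    using pos norm_powr[of "y /\<^sub>R M y"] by (simp add: norm_scale)
  also have "M x / ?s * 1 + M y / ?s * 1 = 1"
    using pos by (simp add: add_divide_distrib[symmetric])
  finally have "M ((x + y) /\<^sub>R ?s) \<le> 1" by (simp add: norm_le_1_iff)
  moreover have "M ((x + y) /\<^sub>R ?s) = M (x + y) / ?s"
    unfolding norm_scale using pos by (simp add: divide_inverse mult.commute)
  ultimately show ?thesis using pos by (simp add: divide_le_eq)
qed

text \<open>The pointwise convexity defect \<open>?f\<close> is positive wherever
  \<open>z \<bullet> x\<close> and \<open>z \<bullet> y\<close> differ. If its integral vanished,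
  \<open>z \<bullet> (x - y)\<close> would be 0 almost everywhere, so
  \<open>\<Lambda> (x - y) = 0\<close>, against nondegeneracy.\<close>

lemma norm_strict:
  assumes "M x = 1" "M y = 1" "x \<noteq> y"
  shows "M ((1/2) *\<^sub>R (x + y)) < 1"
proof -
  let ?f = "\<lambda>z. (\<bar>z \<bullet> x\<bar> powr \<alpha> + \<bar>z \<bullet> y\<bar> powr \<alpha>) / 2 - \<bar>z \<bullet> ((1/2) *\<^sub>R (x + y))\<bar> powr \<alpha>"
  have mid: "z \<bullet> ((1/2) *\<^sub>R (x + y)) = (z \<bullet> x + z \<bullet> y) / 2" for z
    by (simp add: inner_add_right)
  have f_nonneg: "0 \<le> ?f z" and f_pos: "z \<bullet> x \<noteq> z \<bullet> y \<Longrightarrow> 0 < ?f z" for z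
    unfolding mid using abs_powr_midpoint_less[OF \<alpha>, of "z \<bullet> x" "z \<bullet> y"]
    by (cases "z \<bullet> x = z \<bullet> y"; simp)+
  have int_mean: "integrable (spectral_measure \<alpha> \<sigma>) (\<lambda>z. (\<bar>z \<bullet> x\<bar> powr \<alpha> + \<bar>z \<bullet> y\<bar> powr \<alpha>) / 2)"
    using integrable_spectral by simp
  note int = Bochner_Integration.integrable_diff[OF int_mean integrable_spectral[of "(1/2) *\<^sub>R (x + y)"]]
  have \<Lambda>1: "\<Lambda> x = 1" "\<Lambda> y = 1" using norm_powr[of x] norm_powr[of y] assms by simp_all
  have "(LINT z|spectral_measure \<alpha> \<sigma>. ?f z) = (\<Lambda> x + \<Lambda> y) / 2 - \<Lambda> ((1/2) *\<^sub>R (x + y))"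
    unfolding \<Lambda>_def by (subst Bochner_Integration.integral_diff[OF int_mean integrable_spectral])
      (simp add: integrable_spectral)
  then have eq: "(LINT z|spectral_measure \<alpha> \<sigma>. ?f z) = 1 - \<Lambda> ((1/2) *\<^sub>R (x + y))"
    unfolding \<Lambda>1 by simp
  have "(LINT z|spectral_measure \<alpha> \<sigma>. ?f z) \<noteq> 0"
  proof
    assume "(LINT z|spectral_measure \<alpha> \<sigma>. ?f z) = 0"
    then have "AE z in spectral_measure \<alpha> \<sigma>. ?f z = 0"
      using integral_nonneg_eq_0_iff_AE[OF int] f_nonneg by simp
    then have "AE z in spectral_measure \<alpha> \<sigma>. \<bar>z \<bullet> (x - y)\<bar> powr \<alpha> = 0"
      by eventually_elim (use f_pos in \<open>force simp: inner_diff_right\<close>)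
    then have "\<Lambda> (x - y) = 0" unfolding \<Lambda>_def by (rule integral_eq_zero_AE)
    with \<Lambda>_pos[of "x - y"] assms show False by simp
  qed
  moreover have "0 \<le> (LINT z|spectral_measure \<alpha> \<sigma>. ?f z)"
    using f_nonneg by (rule Bochner_Integration.integral_nonneg)
  ultimately have "\<Lambda> ((1/2) *\<^sub>R (x + y)) < 1" using eq by simp
  then show ?thesis
    unfolding norm_eq using \<alpha> powr_less_mono2[of "1 / \<alpha>" "\<Lambda> ((1/2) *\<^sub>R (x + y))" 1] by simp
qed

sublocale strictly_convex_norm M
  by unfold_locales (fact norm_triangle norm_scale norm_pos norm_strict)+

sublocale dual: smooth_norm "dual_norm M" dual_point
  by (rule smooth_norm_dual_norm)

lemma mean_abs_inner:
  assumes "\<xi> \<noteq> 0"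
  shows "(\<integral>\<^sup>+y. ennreal \<bar>y \<bullet> \<xi>\<bar> \<partial>\<mu>) = ennreal (2 / pi * Gamma (1 - 1 / \<alpha>) * M \<xi>)"
proof (rule nn_integral_abs_inner_of_char[OF \<alpha>])
  show "prob_space \<mu>" "sets \<mu> = sets borel"
    using stable by (auto simp: nondegenerate_symmetric_stable_def)
  show "0 < M \<xi>" using assms by (rule norm_pos)
  fix t :: real assume "0 < t"
  then show "(LINT y|\<mu>. exp (\<i> * complex_of_real (y \<bullet> (t *\<^sub>R \<xi>)))) = complex_of_real (exp (- ((M \<xi> * t) powr \<alpha>)))"
    using stable by (simp only: nondegenerate_symmetric_stable_def norm_scale mult.commute[of t] abs_of_pos)
qed

sublocale dual: smooth_norm_prob "dual_norm M" dual_point \<mu> "2 / pi * Gamma (1 - 1 / \<alpha>)"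
proof -
  interpret prob_space \<mu>
    using stable by (simp add: nondegenerate_symmetric_stable_def)
  have [measurable_cong]: "sets \<mu> = sets borel"
    using stable by (simp add: nondegenerate_symmetric_stable_def)
  show "smooth_norm_prob (dual_norm M) dual_point \<mu> (2 / pi * Gamma (1 - 1 / \<alpha>))"
  proof unfold_locales
    show "sets \<mu> = sets borel" by fact
    show "0 \<le> 2 / pi * Gamma (1 - 1 / \<alpha>)"
      using \<alpha> by (intro mult_nonneg_nonneg Gamma_real_nonneg) auto
    show "integrable \<mu> (dual_norm M)"
    proof (rule Bochner_Integration.integrable_bound)
      \<comment> \<open>Finite first moments of the coordinates suffice, since the dual norm is at
        most a weighted sum of their moduli.\<close>
      have "integrable \<mu> (\<lambda>y. \<bar>y \<bullet> b\<bar>)" if "b \<in> Basis" for b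
        using mean_abs_inner[of b] that by (intro integrableI_bounded) (auto simp: nonzero_Basis)
      then show "integrable \<mu> (\<lambda>y. \<Sum>b\<in>Basis. dual_norm M b * \<bar>y \<bullet> b\<bar>)"
        by (intro Bochner_Integration.integrable_sum integrable_mult_right)
      show "AE y in \<mu>. norm (dual_norm M y) \<le> norm (\<Sum>b\<in>Basis. dual_norm M b * \<bar>y \<bullet> b\<bar>)"
        by (intro AE_I2) (smt (verit) dual.le_sum_Basis dual.nonneg real_norm_def)
    qed measurable
    fix x :: 'a assume "x \<noteq> 0"
    \<comment> \<open>The gradient of the dual norm has stable norm 1, which makes the mean
      independent of \<open>x\<close>.\<close>
    then have "M (dual_point x) = 1"
      by (intro norm_maximizer[of x] dual_point)
    moreover from this have "dual_point x \<noteq> 0" by auto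
    ultimately show "(\<integral>\<^sup>+y. ennreal \<bar>y \<bullet> dual_point x\<bar> \<partial>\<mu>) = ennreal (2 / pi * Gamma (1 - 1 / \<alpha>))"
      by (simp add: mean_abs_inner)
  qed
qed

lemma polar_stable_ball: "polar_set (stable_ball \<alpha> \<sigma>) = {x. dual_norm M x \<le> 1}"
  unfolding stable_ball_def by (rule polar_set_ball)

lemma stable_perimeter_polar:
  "stable_perimeter \<alpha> \<sigma> (polar_set (stable_ball \<alpha> \<sigma>)) = ereal (DIM('a) * dual.unit_ball_volume)"
proof -
  have "stable_dual_norm \<alpha> \<sigma> = dual_norm M"
    by (simp add: stable_dual_norm_def dual_norm_def fun_eq_iff)
  then have "(SUP x. ereal \<bar>stable_dual_norm \<alpha> \<sigma> (\<phi> x)\<bar>) \<le> 1 \<longleftrightarrow> (\<forall>x. dual_norm M (\<phi> x) \<le> 1)" for \<phi> :: "'a \<Rightarrow> 'a"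
    by (simp add: SUP_le_iff one_ereal_def)
  then show ?thesis
    unfolding stable_perimeter_def polar_stable_ball by (simp add: dual.perimeter_unit_ball)
qed

text \<open>The limit in \<open>s\<close> is composed with \<open>s = t powr (1 / \<alpha>)\<close>,
  which tends to 0 from the right. The 2 in the mean
  \<open>2 / pi * Gamma (1 - 1 / \<alpha>)\<close> cancels the reflection factor 1 / 2.\<close>

lemma heat_content_polar_tendsto:
  "((\<lambda>t. enn2ereal (heat_content \<alpha> \<mu> t (polar_set (stable_ball \<alpha> \<sigma>)) (- polar_set (stable_ball \<alpha> \<sigma>)))
        / ereal (t powr (1 / \<alpha>)))
      \<longlongrightarrow> ereal (Gamma (1 - 1 / \<alpha>) / pi * (DIM('a) * dual.unit_ball_volume))) (at_right 0)"
proof -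
  have "((\<lambda>t::real. t powr (1 / \<alpha>)) \<longlongrightarrow> 0 powr (1 / \<alpha>)) (at_right 0)"
    using \<alpha> by (intro tendsto_powr' tendsto_intros) (auto simp: eventually_at_filter)
  then have "filterlim (\<lambda>t::real. t powr (1 / \<alpha>)) (at_right 0) (at_right 0)"
    using \<alpha> by (intro tendsto_imp_filterlim_at_right) (auto simp: eventually_at_filter)
  from filterlim_compose[OF dual.mean_overshoot_tendsto this]
  have "((\<lambda>t. ereal (dual.mean_overshoot (t powr (1 / \<alpha>)) / t powr (1 / \<alpha>)))
      \<longlongrightarrow> ereal (Gamma (1 - 1 / \<alpha>) / pi * (DIM('a) * dual.unit_ball_volume))) (at_right 0)"
    by (simp add: field_simps)
  then show ?thesis
    unfolding polar_stable_ball dual.heat_content_unit_ball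
    by (rule Lim_transform_eventually) (auto simp: eventually_at_filter enn2ereal_ennreal)
qed

end

theorem proposition5p4:
  fixes \<alpha> :: real and \<sigma> \<mu> :: "'a::euclidean_space measure"
  assumes "\<alpha> \<in> {1<..<2}"
    and "nondegenerate_symmetric_stable \<alpha> \<sigma> \<mu>"
  shows "((\<lambda>t. enn2ereal (heat_content \<alpha> \<mu> t (polar_set (stable_ball \<alpha> \<sigma>))
                              (- polar_set (stable_ball \<alpha> \<sigma>)))
               / ereal (t powr (1 / \<alpha>)))
          \<longlongrightarrow> ereal (Gamma (1 - 1 / \<alpha>) / pi) * ereal (real DIM('a))
               * enn2ereal (emeasure lborel (polar_set (stable_ball \<alpha> \<sigma>)))) (at_right 0) \<and>
         ereal (Gamma (1 - 1 / \<alpha>) / pi) * ereal (real DIM('a))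
           * enn2ereal (emeasure lborel (polar_set (stable_ball \<alpha> \<sigma>)))
         = ereal (Gamma (1 - 1 / \<alpha>) / pi) * stable_perimeter \<alpha> \<sigma> (polar_set (stable_ball \<alpha> \<sigma>))"
proof -
  interpret nondegenerate_stable \<alpha> \<sigma> \<mu>
    using assms by unfold_locales auto
  \<comment> \<open>The volume is finite, so the extended real products of the statement reduce to
    real ones.\<close>
  have "emeasure lborel (polar_set (stable_ball \<alpha> \<sigma>)) = ennreal dual.unit_ball_volume"
    using dual.emeasure_ball[of 1] by (simp add: polar_stable_ball)
  then show ?thesis
    using heat_content_polar_tendsto by (simp add: stable_perimeter_polar enn2ereal_ennreal mult.assoc)
qed

end
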